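(* Let $(M,\nabla)$ be a smooth manifold with torsion-free connection, $\mathcal{U} \subseteq TM$ an open neighbourhood of the zero section and $\mathcal{V} \subseteq M \times M$ an open neighbourhood of the diagonal such that $\Phi: \mathcal{U} \to \mathcal{V}$, $\Phi(v_p) = (\exp_p(-v_p), \exp_p(v_p))$, is a well-defined diffeomorphism. Let $\theta$ be a $\mathcal{U}$-admissible vertical Poisson structure on $TM$ with vertical action of $\mathbb{R}^d$, fundamental vector fields $X_1, \ldots, X_d$ and skew-symmetric matrix $\Theta$. Let $\star$ be the deformed product on smooth vectors of functions on $\mathcal{U}$ defined by the induced action $\alpha$ and $\Theta$, and $\tilde{\star}$ the deformed product on smooth vectors of functions on $\mathcal{V}$ defined by the action $\tilde{\alpha}$ with fundamental vector fields $\tilde{X}_i = \Phi_* X_i$ and $\Theta$. Then the pull-back $\Phi^*: C^0(\mathcal{V}) \to C^0(\mathcal{U})$ restricts to a $^*$-isomorphism $$\Phi^*: (C^0(\mathcal{V})^\infty, \tilde{\star}) \longrightarrow (C^0(\mathcal{U})^\infty, \star)$$ continuous with respect to the deformed pro-$C^*$-topologies. It restricts to $^*$-isomorphisms $\Phi^*: (C^0_b(\mathcal{V})^\infty, \tilde{\star}) \to (C^0_b(\mathcal{U})^\infty, \star)$ and $\Phi^*: (C^0_\infty(\mathcal{V})^\infty, \tilde{\star}) \to (C^0_\infty(\mathcal{U})^\infty, \star)$, continuous with respect to the deformed $C^*$-topologies. In all cases, the inverse is given by $\Phi_*$.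
   Context: Admissibility: a vertical Poisson structure $\theta$ on $TM$ is $\mathcal{U}$-admissible if there are a smooth action of $\mathbb{R}^d$ on $TM$ by vertical diffeomorphisms (mapping each $T_pM$ to itself), with (vertical) fundamental vector fields $X_1,\ldots,X_d$, and constants $\Theta^{ij} = -\Theta^{ji} \in \mathbb{R}$ with $\theta = \frac12\sum_{i,j}\Theta^{ij} X_i \wedge X_j$, $\operatorname{supp} X_i \subseteq \mathcal{U}$, and $\operatorname{supp} X_i \cap T_pM$ compact for all $p \in M$. $\Theta$ also denotes the skew-symmetric operator on $\mathbb{R}^d$ with matrix $(\Theta^{ij})$. Commuting complete vector fields $Z_1,\ldots,Z_d$ with flows $\phi^{Z_i}$ induce the action $\alpha_v(f) = f\circ\phi^{Z_1}_{v_1}\circ\cdots\circ\phi^{Z_d}_{v_d}$ on functions. Since the $X_i$ are supported in $\mathcal{U}$, the open set $\mathcal{U}$ is invariant and $\alpha$ acts on functions on $\mathcal{U}$; likewise $\tilde{\alpha}$ on functions on $\mathcal{V}$ (in the paper $\tilde X_i$ is moreover extended by $0$ to $M\times M$). Function algebras: for a manifold $N$, $C^0(N)$ denotes all continuous complex functions (a pro-$C^*$-algebra with the seminorms $\|f\|_L=\sup_L|f|$, $L$ compact), $C^0_b(N)$ the bounded ones and $C^0_\infty(N)$ those vanishing at infinity ($C^*$-algebras with the sup-norm). The involution is complex conjugation. Deformed product: let $\mathcal{A}$ be one of these algebras, with an action $\alpha$ of $\mathbb{R}^d$. $\mathcal{A}^\infty$ is the set of smooth vectors ($v\mapsto\alpha_v(a)$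 is smooth into $\mathcal{A}$), and $a \star b = \iint \alpha_{\Theta u}(a)\,\alpha_v(b)\, e^{2\pi i u\cdot v}\,du\,dv$ for $a,b\in\mathcal{A}^\infty$. Here the oscillatory integral of a function $F$ on $\mathbb{R}^d\times\mathbb{R}^d$ that is bounded with all derivatives is $\sum_w\iint F\varphi_w e^{2\pi i u\cdot v}\,du\,dv$, with $\{\varphi_w\}$ a smooth partition of unity consisting of lattice translates of one compactly supported smooth function. Deformed topology: $C^0_u(\mathbb{R}^d,\mathcal{A})^\infty$ denotes the smooth vectors for translation in the bounded uniformly continuous functions $\mathbb{R}^d\to\mathcal{A}$, with product $(F\star G)(x)=\iint F(x+\Theta u)G(x+v)e^{2\pi i u\cdot v}\,du\,dv$. $\mathcal{S}^{\mathcal{A}}(\mathbb{R}^d)$ is the subspace of those $f$ all of whose derivatives multiplied by any polynomial are bounded, with $\langle f,g\rangle=\int f(v)^*g(v)\,dv$ and $\|f\|_q=q(\langle f,f\rangle)^{1/2}$ for each continuous $C^*$-seminorm $q$ on $\mathcal{A}$. For $a\in\mathcal{A}^\infty$ put $\phi(a)(v)=\alpha_v(a)$ and $\mathsf{L}_{\phi(a)}g=\phi(a)\star g$ on $\mathcal{S}^{\mathcal{A}}(\mathbb{R}^d)$, and $\|a\|_{\Theta,q}=\sup\{\|\mathsf{L}_{\phi(a)}g\|_q:\|g\|_q\le1\}$. The deformed pro-$C^*$-topology on $\mathcal{A}^\infty$ is defined by all seminorms $\|\cdot\|_{\Theta,q}$; if $\mathcal{A}$ is a $C^*$-algebra, the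 deformed $C^*$-topology is given by $\|\cdot\|_\Theta$, where $q$ is the $C^*$-norm. *)

theory Defs
  imports "HOL-Analysis.Analysis"
begin

section \<open>Smooth maps between Euclidean spaces\<close>

text \<open>Both notions are meant for open sets. On an open subset of a Euclidean space, having
  iterated directional derivatives of all orders that are all differentiable is being
  of class C-infinity.\<close>

primrec higher_differentiable_on ::
    "'a::real_normed_vector set \<Rightarrow> ('a \<Rightarrow> 'b::real_normed_vector) \<Rightarrow> nat \<Rightarrow> bool" where
  "higher_differentiable_on S f 0 \<longleftrightarrow> continuous_on S f"
| "higher_differentiable_on S f (Suc n) \<longleftrightarrow>
     (\<forall>x\<in>S. f differentiable (at x)) \<and>
     (\<forall>h. higher_differentiable_on S (\<lambda>x. frechet_derivative f (at x) h) n)"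

definition smooth_on :: "'a::real_normed_vector set \<Rightarrow> ('a \<Rightarrow> 'b::real_normed_vector) \<Rightarrow> bool" where
  "smooth_on S f \<longleftrightarrow> (\<forall>n. higher_differentiable_on S f n)"


section \<open>Manifolds, tangent vectors and vector fields\<close>

text \<open>A chart is a pair of its domain and its coordinate map (whose values off the domain
  are irrelevant). A manifold is given by an atlas; its points are the members of the
  chart domains.\<close>

type_synonym ('a, 'e) chart = "'a set \<times> ('a \<Rightarrow> 'e)"
type_synonym ('a, 'e) atlas = "('a, 'e) chart set"

definition points :: "('a, 'e) atlas \<Rightarrow> 'a set" where
  "points A = (\<Union>c\<in>A. fst c)"

definition chart_inv :: "('a, 'e) chart \<Rightarrow> 'e \<Rightarrow> 'a" where
  "chart_inv c = inv_into (fst c) (snd c)"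

definition chart_at :: "('a, 'e) atlas \<Rightarrow> 'a \<Rightarrow> ('a, 'e) chart" where
  "chart_at A x = (SOME c. c \<in> A \<and> x \<in> fst c)"

definition smooth_atlas :: "('a, 'e::euclidean_space) atlas \<Rightarrow> bool" where
  "smooth_atlas A \<longleftrightarrow>
     (\<forall>c\<in>A. inj_on (snd c) (fst c) \<and> open (snd c ` fst c)) \<and>
     (\<forall>c\<in>A. \<forall>c'\<in>A. open (snd c ` (fst c \<inter> fst c')) \<and>
        smooth_on (snd c ` (fst c \<inter> fst c')) (snd c' \<circ> chart_inv c))"

definition mtop :: "('a, 'e::euclidean_space) atlas \<Rightarrow> 'a topology" where
  "mtop A = topology_generated_by {fst c \<inter> snd c -` W | c W. c \<in> A \<and> open W}"

definition smooth_manifold :: "('a, 'e::euclidean_space) atlas \<Rightarrow> bool" where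
  "smooth_manifold A \<longleftrightarrow> smooth_atlas A \<and> Hausdorff_space (mtop A) \<and> second_countable (mtop A)"

definition prod_atlas :: "('a, 'e) atlas \<Rightarrow> ('b, 'f) atlas \<Rightarrow> ('a \<times> 'b, 'e \<times> 'f) atlas" where
  "prod_atlas A B = {(fst c \<times> fst c', map_prod (snd c) (snd c')) | c c'. c \<in> A \<and> c' \<in> B}"

definition smooth_map ::
    "('a, 'e::euclidean_space) atlas \<Rightarrow> 'a set \<Rightarrow> ('b, 'f::euclidean_space) atlas \<Rightarrow> ('a \<Rightarrow> 'b) \<Rightarrow> bool"
  where
  "smooth_map A S B F \<longleftrightarrow>
     continuous_map (subtopology (mtop A) S) (mtop B) F \<and>
     (\<forall>c\<in>A. \<forall>c'\<in>B. smooth_on (snd c ` {x \<in> S \<inter> fst c. F x \<in> fst c'}) (snd c' \<circ> F \<circ> chart_inv c))"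

definition diffeomorphism ::
    "('a, 'e::euclidean_space) atlas \<Rightarrow> 'a set \<Rightarrow> ('b, 'f::euclidean_space) atlas \<Rightarrow> 'b set \<Rightarrow> ('a \<Rightarrow> 'b) \<Rightarrow> bool"
  where
  "diffeomorphism A S B T F \<longleftrightarrow>
     bij_betw F S T \<and> smooth_map A S B F \<and> smooth_map B T A (inv_into S F)"

definition smooth_fun :: "('a, 'e::euclidean_space) atlas \<Rightarrow> ('a \<Rightarrow> real) \<Rightarrow> bool" where
  "smooth_fun A f \<longleftrightarrow> (\<forall>c\<in>A. smooth_on (snd c ` fst c) (f \<circ> chart_inv c))"

text \<open>A tangent vector at a point is the family of its coordinate vectors in all charts
  around the point, related by the derivatives of the transition maps (and by convention
  0 at all other charts).\<close>

type_synonym ('a, 'e) tangent = "('a, 'e) chart \<Rightarrow> 'e"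

definition tangent_space :: "('a, 'e::euclidean_space) atlas \<Rightarrow> 'a \<Rightarrow> ('a, 'e) tangent set" where
  "tangent_space A x =
     {\<xi>. (\<forall>c. \<not> (c \<in> A \<and> x \<in> fst c) \<longrightarrow> \<xi> c = 0) \<and>
         (\<forall>c\<in>A. \<forall>c'\<in>A. x \<in> fst c \<inter> fst c' \<longrightarrow>
            \<xi> c' = frechet_derivative (snd c' \<circ> chart_inv c) (at (snd c x)) (\<xi> c))}"

definition tangent_map ::
    "('a, 'e::euclidean_space) atlas \<Rightarrow> ('b, 'f::euclidean_space) atlas \<Rightarrow> ('a \<Rightarrow> 'b) \<Rightarrow> 'a
      \<Rightarrow> ('a, 'e) tangent \<Rightarrow> ('b, 'f) tangent" where
  "tangent_map A B F x \<xi> =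
     (let c = chart_at A x in
      (\<lambda>c'. if c' \<in> B \<and> F x \<in> fst c'
           then frechet_derivative (snd c' \<circ> F \<circ> chart_inv c) (at (snd c x)) (\<xi> c) else 0))"

definition differential ::
    "('a, 'e::euclidean_space) atlas \<Rightarrow> ('a \<Rightarrow> real) \<Rightarrow> 'a \<Rightarrow> ('a, 'e) tangent \<Rightarrow> real" where
  "differential A f x \<xi> =
     (let c = chart_at A x in
      (if \<xi> \<in> tangent_space A x
      then frechet_derivative (f \<circ> chart_inv c) (at (snd c x)) (\<xi> c) else 0))"

definition vector_field ::
    "('a, 'e::euclidean_space) atlas \<Rightarrow> ('a \<Rightarrow> ('a, 'e) tangent) \<Rightarrow> bool" where
  "vector_field A X \<longleftrightarrow>
     (\<forall>x\<in>points A. X x \<in> tangent_space A x) \<and> (\<forall>x. x \<notin> points A \<longrightarrow> X x = (\<lambda>c. 0)) \<and>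
     (\<forall>c\<in>A. smooth_on (snd c ` fst c) (\<lambda>y. X (chart_inv c y) c))"

definition pushforward ::
    "('a, 'e::euclidean_space) atlas \<Rightarrow> 'a set \<Rightarrow> ('b, 'f::euclidean_space) atlas \<Rightarrow> ('a \<Rightarrow> 'b)
      \<Rightarrow> ('a \<Rightarrow> ('a, 'e) tangent) \<Rightarrow> 'b \<Rightarrow> ('b, 'f) tangent" where
  "pushforward A S B F X y =
     (if y \<in> F ` S then tangent_map A B F (inv_into S F y) (X (inv_into S F y)) else (\<lambda>c. 0))"

text \<open>The tangent bundle, with the atlas induced by an atlas of the base.\<close>

definition tangent_atlas ::
    "('a, 'e::euclidean_space) atlas \<Rightarrow> ('a \<times> ('a, 'e) tangent, 'e \<times> 'e) atlas" where
  "tangent_atlas A =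
     (\<lambda>c. ({(p, \<xi>). p \<in> fst c \<and> \<xi> \<in> tangent_space A p}, \<lambda>(p, \<xi>). (snd c p, \<xi> c))) ` A"

definition zero_section :: "('a, 'e::euclidean_space) atlas \<Rightarrow> ('a \<times> ('a, 'e) tangent) set" where
  "zero_section A = {(p, \<lambda>c. 0) | p. p \<in> points A}"


section \<open>Connections, geodesics and the exponential map\<close>

text \<open>A connection is a covariant derivative on vector fields, \<^term>\<open>nabla X Y\<close> being the
  derivative of \<^term>\<open>Y\<close> in direction \<^term>\<open>X\<close>.\<close>

definition affine_connection ::
    "('a, 'e::euclidean_space) atlas
      \<Rightarrow> (('a \<Rightarrow> ('a, 'e) tangent) \<Rightarrow> ('a \<Rightarrow> ('a, 'e) tangent) \<Rightarrow> 'a \<Rightarrow> ('a, 'e) tangent) \<Rightarrow> bool" where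
  "affine_connection A nabla \<longleftrightarrow>
     (\<forall>X Y. vector_field A X \<and> vector_field A Y \<longrightarrow> vector_field A (nabla X Y)) \<and>
     (\<forall>X X' Y. vector_field A X \<and> vector_field A X' \<and> vector_field A Y \<longrightarrow>
        nabla (\<lambda>x c. X x c + X' x c) Y = (\<lambda>x c. nabla X Y x c + nabla X' Y x c)) \<and>
     (\<forall>f X Y. smooth_fun A f \<and> vector_field A X \<and> vector_field A Y \<longrightarrow>
        nabla (\<lambda>x c. f x *\<^sub>R X x c) Y = (\<lambda>x c. f x *\<^sub>R nabla X Y x c)) \<and>
     (\<forall>X Y Y'. vector_field A X \<and> vector_field A Y \<and> vector_field A Y' \<longrightarrow>
        nabla X (\<lambda>x c. Y x c + Y' x c) = (\<lambda>x c. nabla X Y x c + nabla X Y' x c)) \<and>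
     (\<forall>f X Y. smooth_fun A f \<and> vector_field A X \<and> vector_field A Y \<longrightarrow>
        nabla X (\<lambda>x c. f x *\<^sub>R Y x c)
          = (\<lambda>x c. f x *\<^sub>R nabla X Y x c + differential A f x (X x) *\<^sub>R Y x c))"

text \<open>Torsion-freeness: \<^term>\<open>nabla X Y\<close> minus \<^term>\<open>nabla Y X\<close> is the Lie bracket of
  \<^term>\<open>X\<close> and \<^term>\<open>Y\<close>, i.e. acts on functions as the commutator of the derivations.\<close>

definition torsion_free ::
    "('a, 'e::euclidean_space) atlas
      \<Rightarrow> (('a \<Rightarrow> ('a, 'e) tangent) \<Rightarrow> ('a \<Rightarrow> ('a, 'e) tangent) \<Rightarrow> 'a \<Rightarrow> ('a, 'e) tangent) \<Rightarrow> bool" where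
  "torsion_free A nabla \<longleftrightarrow>
     (\<forall>X Y f. vector_field A X \<and> vector_field A Y \<and> smooth_fun A f \<longrightarrow>
        (\<forall>x\<in>points A.
           differential A f x (nabla X Y x) - differential A f x (nabla Y X x)
           = differential A (\<lambda>y. differential A f y (Y y)) x (X x)
             - differential A (\<lambda>y. differential A f y (X y)) x (Y x)))"

definition locally_constant_field ::
    "('a, 'e::euclidean_space) atlas \<Rightarrow> ('a, 'e) chart \<Rightarrow> 'a \<Rightarrow> 'e \<Rightarrow> ('a \<Rightarrow> ('a, 'e) tangent) \<Rightarrow> bool"
  where
  "locally_constant_field A c x u X \<longleftrightarrow>
     vector_field A X \<and> (\<exists>W. openin (mtop A) W \<and> x \<in> W \<and> W \<subseteq> fst c \<and> (\<forall>y\<in>W. X y c = u))"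

text \<open>The Christoffel symbols of the chart \<^term>\<open>c\<close> at \<^term>\<open>x\<close>, as a bilinear map. A connection
  is local, and vector fields with constant coordinates near \<^term>\<open>x\<close> exist by means of
  bump functions, so the choices do not matter.\<close>

definition christoffel ::
    "('a, 'e::euclidean_space) atlas
      \<Rightarrow> (('a \<Rightarrow> ('a, 'e) tangent) \<Rightarrow> ('a \<Rightarrow> ('a, 'e) tangent) \<Rightarrow> 'a \<Rightarrow> ('a, 'e) tangent)
      \<Rightarrow> ('a, 'e) chart \<Rightarrow> 'a \<Rightarrow> 'e \<Rightarrow> 'e \<Rightarrow> 'e" where
  "christoffel A nabla c x u w =
     nabla (SOME X. locally_constant_field A c x u X) (SOME Y. locally_constant_field A c x w Y) x c"

text \<open>A geodesic \<^term>\<open>\<gamma>\<close> on the open interval from \<^term>\<open>a\<close> to \<^term>\<open>b\<close>; \<^term>\<open>\<gamma>'\<close> is its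
  velocity.\<close>

definition geodesic ::
    "('a, 'e::euclidean_space) atlas
      \<Rightarrow> (('a \<Rightarrow> ('a, 'e) tangent) \<Rightarrow> ('a \<Rightarrow> ('a, 'e) tangent) \<Rightarrow> 'a \<Rightarrow> ('a, 'e) tangent)
      \<Rightarrow> real \<Rightarrow> real \<Rightarrow> (real \<Rightarrow> 'a) \<Rightarrow> (real \<Rightarrow> ('a, 'e) tangent) \<Rightarrow> bool" where
  "geodesic A nabla a b \<gamma> \<gamma>' \<longleftrightarrow>
     continuous_map (top_of_set {a<..<b}) (mtop A) \<gamma> \<and>
     (\<forall>t\<in>{a<..<b}. \<gamma>' t \<in> tangent_space A (\<gamma> t)) \<and>
     (\<forall>t\<in>{a<..<b}. \<forall>c\<in>A. \<gamma> t \<in> fst c \<longrightarrow>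
        ((snd c \<circ> \<gamma>) has_vector_derivative \<gamma>' t c) (at t) \<and>
        ((\<lambda>s. \<gamma>' s c) has_vector_derivative - christoffel A nabla c (\<gamma> t) (\<gamma>' t c) (\<gamma>' t c)) (at t))"

definition is_exp ::
    "('a, 'e::euclidean_space) atlas
      \<Rightarrow> (('a \<Rightarrow> ('a, 'e) tangent) \<Rightarrow> ('a \<Rightarrow> ('a, 'e) tangent) \<Rightarrow> 'a \<Rightarrow> ('a, 'e) tangent)
      \<Rightarrow> 'a \<Rightarrow> ('a, 'e) tangent \<Rightarrow> 'a \<Rightarrow> bool" where
  "is_exp A nabla p \<xi> q \<longleftrightarrow>
     (\<exists>a b \<gamma> \<gamma>'. a < 0 \<and> 1 < b \<and> geodesic A nabla a b \<gamma> \<gamma>' \<and> \<gamma> 0 = p \<and> \<gamma>' 0 = \<xi> \<and> \<gamma> 1 = q)"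

definition exp_map ::
    "('a, 'e::euclidean_space) atlas
      \<Rightarrow> (('a \<Rightarrow> ('a, 'e) tangent) \<Rightarrow> ('a \<Rightarrow> ('a, 'e) tangent) \<Rightarrow> 'a \<Rightarrow> ('a, 'e) tangent)
      \<Rightarrow> 'a \<Rightarrow> ('a, 'e) tangent \<Rightarrow> 'a" where
  "exp_map A nabla p \<xi> = (THE q. is_exp A nabla p \<xi> q)"

definition sym_exp ::
    "('a, 'e::euclidean_space) atlas
      \<Rightarrow> (('a \<Rightarrow> ('a, 'e) tangent) \<Rightarrow> ('a \<Rightarrow> ('a, 'e) tangent) \<Rightarrow> 'a \<Rightarrow> ('a, 'e) tangent)
      \<Rightarrow> 'a \<times> ('a, 'e) tangent \<Rightarrow> 'a \<times> 'a" where
  "sym_exp A nabla = (\<lambda>(p, \<xi>). (exp_map A nabla p (\<lambda>c. - \<xi> c), exp_map A nabla p \<xi>))"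

definition sym_exp_defined_on ::
    "('a, 'e::euclidean_space) atlas
      \<Rightarrow> (('a \<Rightarrow> ('a, 'e) tangent) \<Rightarrow> ('a \<Rightarrow> ('a, 'e) tangent) \<Rightarrow> 'a \<Rightarrow> ('a, 'e) tangent)
      \<Rightarrow> ('a \<times> ('a, 'e) tangent) set \<Rightarrow> bool" where
  "sym_exp_defined_on A nabla S \<longleftrightarrow>
     (\<forall>(p, \<xi>)\<in>S. (\<exists>!q. is_exp A nabla p (\<lambda>c. - \<xi> c) q) \<and> (\<exists>!q. is_exp A nabla p \<xi> q))"


section \<open>Vertical Poisson structures and admissibility\<close>

definition cotangent_space ::
    "('a, 'e::euclidean_space) atlas \<Rightarrow> 'a \<Rightarrow> (('a, 'e) tangent \<Rightarrow> real) set" where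
  "cotangent_space A x =
     {\<mu>. (\<forall>\<xi>\<in>tangent_space A x. \<forall>\<eta>\<in>tangent_space A x. \<mu> (\<lambda>c. \<xi> c + \<eta> c) = \<mu> \<xi> + \<mu> \<eta>) \<and>
         (\<forall>r. \<forall>\<xi>\<in>tangent_space A x. \<mu> (\<lambda>c. r *\<^sub>R \<xi> c) = r * \<mu> \<xi>) \<and>
         (\<forall>\<xi>. \<xi> \<notin> tangent_space A x \<longrightarrow> \<mu> \<xi> = 0)}"

text \<open>A bivector at a point is an alternating bilinear form on the cotangent space; only its
  values on covectors matter.\<close>

type_synonym ('a, 'e) bivector =
  "(('a, 'e) tangent \<Rightarrow> real) \<Rightarrow> (('a, 'e) tangent \<Rightarrow> real) \<Rightarrow> real"

definition bivector_at :: "('a, 'e::euclidean_space) atlas \<Rightarrow> 'a \<Rightarrow> ('a, 'e) bivector \<Rightarrow> bool" where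
  "bivector_at A x \<beta> \<longleftrightarrow>
     (\<forall>\<mu>\<in>cotangent_space A x. \<beta> \<mu> \<mu> = 0) \<and>
     (\<forall>\<mu>\<in>cotangent_space A x. \<forall>\<mu>'\<in>cotangent_space A x. \<forall>\<nu>\<in>cotangent_space A x. \<forall>r.
        \<beta> (\<lambda>\<xi>. \<mu> \<xi> + \<mu>' \<xi>) \<nu> = \<beta> \<mu> \<nu> + \<beta> \<mu>' \<nu> \<and> \<beta> (\<lambda>\<xi>. r * \<mu> \<xi>) \<nu> = r * \<beta> \<mu> \<nu> \<and>
        \<beta> \<nu> (\<lambda>\<xi>. \<mu> \<xi> + \<mu>' \<xi>) = \<beta> \<nu> \<mu> + \<beta> \<nu> \<mu>' \<and> \<beta> \<nu> (\<lambda>\<xi>. r * \<mu> \<xi>) = r * \<beta> \<nu> \<mu>)"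

definition wedge :: "('a, 'e) tangent \<Rightarrow> ('a, 'e) tangent \<Rightarrow> ('a, 'e) bivector" where
  "wedge \<xi> \<eta> = (\<lambda>\<mu> \<nu>. \<mu> \<xi> * \<nu> \<eta> - \<mu> \<eta> * \<nu> \<xi>)"

definition poisson_bracket ::
    "('a, 'e::euclidean_space) atlas \<Rightarrow> ('a \<Rightarrow> ('a, 'e) bivector) \<Rightarrow> ('a \<Rightarrow> real) \<Rightarrow> ('a \<Rightarrow> real) \<Rightarrow> 'a \<Rightarrow> real"
  where
  "poisson_bracket A \<theta> f g = (\<lambda>x. \<theta> x (differential A f x) (differential A g x))"

definition poisson_structure ::
    "('a, 'e::euclidean_space) atlas \<Rightarrow> ('a \<Rightarrow> ('a, 'e) bivector) \<Rightarrow> bool" where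
  "poisson_structure A \<theta> \<longleftrightarrow>
     (\<forall>x\<in>points A. bivector_at A x (\<theta> x)) \<and>
     (\<forall>f g. smooth_fun A f \<and> smooth_fun A g \<longrightarrow> smooth_fun A (poisson_bracket A \<theta> f g)) \<and>
     (\<forall>f g h. smooth_fun A f \<and> smooth_fun A g \<and> smooth_fun A h \<longrightarrow>
        (\<forall>x\<in>points A.
           poisson_bracket A \<theta> (poisson_bracket A \<theta> f g) h x
           + poisson_bracket A \<theta> (poisson_bracket A \<theta> g h) f x
           + poisson_bracket A \<theta> (poisson_bracket A \<theta> h f) g x = 0))"

definition vertical_space ::
    "('m, 'e::euclidean_space) atlas \<Rightarrow> 'm \<times> ('m, 'e) tangent
      \<Rightarrow> ('m \<times> ('m, 'e) tangent, 'e \<times> 'e) tangent set" where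
  "vertical_space M x =
     {\<zeta> \<in> tangent_space (tangent_atlas M) x. tangent_map (tangent_atlas M) M fst x \<zeta> = (\<lambda>c. 0)}"

text \<open>A bivector lies in the second exterior power of the vertical space iff it is annihilated
  by the covectors that vanish on vertical vectors.\<close>

definition vertical_poisson_structure ::
    "('m, 'e::euclidean_space) atlas
      \<Rightarrow> ('m \<times> ('m, 'e) tangent \<Rightarrow> ('m \<times> ('m, 'e) tangent, 'e \<times> 'e) bivector) \<Rightarrow> bool" where
  "vertical_poisson_structure M \<theta> \<longleftrightarrow>
     poisson_structure (tangent_atlas M) \<theta> \<and>
     (\<forall>x\<in>points (tangent_atlas M).
        \<forall>\<mu>\<in>cotangent_space (tangent_atlas M) x. \<forall>\<nu>\<in>cotangent_space (tangent_atlas M) x.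
          (\<forall>\<zeta>\<in>vertical_space M x. \<mu> \<zeta> = 0) \<longrightarrow> \<theta> x \<mu> \<nu> = 0)"

definition vector_field_support ::
    "('a, 'e::euclidean_space) atlas \<Rightarrow> ('a \<Rightarrow> ('a, 'e) tangent) \<Rightarrow> 'a set" where
  "vector_field_support A X = (mtop A) closure_of {x \<in> points A. X x \<noteq> (\<lambda>c. 0)}"

definition smooth_vertical_action ::
    "('m, 'e::euclidean_space) atlas
      \<Rightarrow> (real^'d \<Rightarrow> 'm \<times> ('m, 'e) tangent \<Rightarrow> 'm \<times> ('m, 'e) tangent) \<Rightarrow> bool" where
  "smooth_vertical_action M \<psi> \<longleftrightarrow>
     smooth_map (prod_atlas {(UNIV, id)} (tangent_atlas M)) (UNIV \<times> points (tangent_atlas M))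
       (tangent_atlas M) (\<lambda>(v, x). \<psi> v x) \<and>
     (\<forall>x\<in>points (tangent_atlas M).
        \<psi> 0 x = x \<and> (\<forall>u v. \<psi> (u + v) x = \<psi> u (\<psi> v x)) \<and> (\<forall>v. fst (\<psi> v x) = fst x))"

definition fundamental_vector_fields ::
    "('a, 'e::euclidean_space) atlas \<Rightarrow> (real^'d \<Rightarrow> 'a \<Rightarrow> 'a) \<Rightarrow> ('d::finite \<Rightarrow> 'a \<Rightarrow> ('a, 'e) tangent) \<Rightarrow> bool"
  where
  "fundamental_vector_fields A \<psi> X \<longleftrightarrow>
     (\<forall>i. vector_field A (X i) \<and>
       (\<forall>x\<in>points A. \<forall>c\<in>A. x \<in> fst c \<longrightarrow>
          ((\<lambda>t. snd c (\<psi> (t *\<^sub>R axis i 1) x)) has_vector_derivative X i x c) (at 0)))"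

text \<open>The given data witness that \<^term>\<open>\<theta>\<close> is \<^term>\<open>U\<close>-admissible.\<close>

definition admissible_via ::
    "('m, 'e::euclidean_space) atlas \<Rightarrow> ('m \<times> ('m, 'e) tangent) set
      \<Rightarrow> ('m \<times> ('m, 'e) tangent \<Rightarrow> ('m \<times> ('m, 'e) tangent, 'e \<times> 'e) bivector)
      \<Rightarrow> (real^'d \<Rightarrow> 'm \<times> ('m, 'e) tangent \<Rightarrow> 'm \<times> ('m, 'e) tangent)
      \<Rightarrow> ('d::finite \<Rightarrow> 'm \<times> ('m, 'e) tangent \<Rightarrow> ('m \<times> ('m, 'e) tangent, 'e \<times> 'e) tangent)
      \<Rightarrow> real^'d^'d \<Rightarrow> bool" where
  "admissible_via M U \<theta> \<psi> X \<Theta> \<longleftrightarrow>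
     smooth_vertical_action M \<psi> \<and>
     fundamental_vector_fields (tangent_atlas M) \<psi> X \<and>
     (\<forall>i j. \<Theta> $ i $ j = - (\<Theta> $ j $ i)) \<and>
     (\<forall>x\<in>points (tangent_atlas M).
        \<forall>\<mu>\<in>cotangent_space (tangent_atlas M) x. \<forall>\<nu>\<in>cotangent_space (tangent_atlas M) x.
          \<theta> x \<mu> \<nu> = 1/2 * (\<Sum>i\<in>UNIV. \<Sum>j\<in>UNIV. \<Theta> $ i $ j * wedge (X i x) (X j x) \<mu> \<nu>)) \<and>
     (\<forall>i. vector_field_support (tangent_atlas M) (X i) \<subseteq> U) \<and>
     (\<forall>i. \<forall>p\<in>points M. compactin (mtop (tangent_atlas M))
        (vector_field_support (tangent_atlas M) (X i) \<inter> ({p} \<times> tangent_space M p)))"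


section \<open>Flows and the induced action on functions\<close>

definition integral_curve ::
    "('a, 'e::euclidean_space) atlas \<Rightarrow> 'a set \<Rightarrow> ('a \<Rightarrow> ('a, 'e) tangent) \<Rightarrow> (real \<Rightarrow> 'a) \<Rightarrow> bool" where
  "integral_curve A S Z \<gamma> \<longleftrightarrow>
     continuous_map euclideanreal (subtopology (mtop A) S) \<gamma> \<and>
     (\<forall>t. \<forall>c\<in>A. \<gamma> t \<in> fst c \<longrightarrow> ((snd c \<circ> \<gamma>) has_vector_derivative Z (\<gamma> t) c) (at t))"

text \<open>The flow of a complete vector field on the open set \<^term>\<open>S\<close>. The else-branch only makes
  the function total.\<close>

definition flow ::
    "('a, 'e::euclidean_space) atlas \<Rightarrow> 'a set \<Rightarrow> ('a \<Rightarrow> ('a, 'e) tangent) \<Rightarrow> real \<Rightarrow> 'a \<Rightarrow> 'a" where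
  "flow A S Z t x =
     (if \<exists>!\<gamma>. integral_curve A S Z \<gamma> \<and> \<gamma> 0 = x
      then (THE \<gamma>. integral_curve A S Z \<gamma> \<and> \<gamma> 0 = x) t else x)"

text \<open>Composition of the flows of \<^term>\<open>Z i\<close> at time \<^term>\<open>v $ i\<close> in the order of the indices,
  the smallest one outermost.\<close>

definition composed_flows ::
    "('a, 'e::euclidean_space) atlas \<Rightarrow> 'a set \<Rightarrow> ('d::{finite,linorder} \<Rightarrow> 'a \<Rightarrow> ('a, 'e) tangent)
      \<Rightarrow> real^'d::{finite,linorder} \<Rightarrow> 'a \<Rightarrow> 'a" where
  "composed_flows A S Z v = foldr (\<lambda>i. (\<circ>) (flow A S (Z i) (v $ i))) (sorted_list_of_set UNIV) id"

text \<open>Functions on a set \<^term>\<open>N\<close> are represented by total functions vanishing off \<^term>\<open>N\<close>.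
  The vector fields live on \<^term>\<open>S\<close>, which contains the invariant set \<^term>\<open>N\<close>.\<close>

definition induced_action ::
    "('a, 'e::euclidean_space) atlas \<Rightarrow> 'a set \<Rightarrow> 'a set \<Rightarrow> ('d::{finite,linorder} \<Rightarrow> 'a \<Rightarrow> ('a, 'e) tangent)
      \<Rightarrow> real^'d::{finite,linorder} \<Rightarrow> ('a \<Rightarrow> complex) \<Rightarrow> 'a \<Rightarrow> complex" where
  "induced_action A S N Z v f = (\<lambda>x. if x \<in> N then f (composed_flows A S Z v x) else 0)"

definition pullback :: "'a set \<Rightarrow> ('a \<Rightarrow> 'b) \<Rightarrow> ('b \<Rightarrow> complex) \<Rightarrow> 'a \<Rightarrow> complex" where
  "pullback S F f = (\<lambda>x. if x \<in> S then f (F x) else 0)"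

definition push_function :: "'a set \<Rightarrow> ('a \<Rightarrow> 'b) \<Rightarrow> ('a \<Rightarrow> complex) \<Rightarrow> 'b \<Rightarrow> complex" where
  "push_function S F f = (\<lambda>y. if y \<in> F ` S then f (inv_into S F y) else 0)"


section \<open>Function algebras\<close>

text \<open>The topological space is the subspace \<^term>\<open>N\<close> of \<^term>\<open>T\<close>. Suprema are taken with 0
  adjoined so that they are also meaningful over the empty set.\<close>

definition C0 :: "'n topology \<Rightarrow> 'n set \<Rightarrow> ('n \<Rightarrow> complex) set" where
  "C0 T N = {f. continuous_map (subtopology T N) euclidean f \<and> (\<forall>x. x \<notin> N \<longrightarrow> f x = 0)}"

definition C0_bdd :: "'n topology \<Rightarrow> 'n set \<Rightarrow> ('n \<Rightarrow> complex) set" where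
  "C0_bdd T N = {f \<in> C0 T N. bounded (f ` N)}"

definition C0_van :: "'n topology \<Rightarrow> 'n set \<Rightarrow> ('n \<Rightarrow> complex) set" where
  "C0_van T N =
     {f \<in> C0 T N. \<forall>e>0. \<exists>L. compactin T L \<and> L \<subseteq> N \<and> (\<forall>x\<in>N - L. norm (f x) < e)}"

definition sup_seminorm :: "'n set \<Rightarrow> ('n \<Rightarrow> complex) \<Rightarrow> real" where
  "sup_seminorm L f = Sup (insert 0 ((\<lambda>x. norm (f x)) ` L))"

definition compact_seminorms :: "'n topology \<Rightarrow> 'n set \<Rightarrow> (('n \<Rightarrow> complex) \<Rightarrow> real) set" where
  "compact_seminorms T N = sup_seminorm ` {L. compactin T L \<and> L \<subseteq> N}"


section \<open>Analysis in a topological algebra of functions\<close>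

text \<open>Throughout, \<^term>\<open>A\<close> is a set of complex functions closed under the pointwise operations
  of a *-algebra, with the topology defined by a separating family \<^term>\<open>P\<close> of seminorms.
  Limits, derivatives, integrals and sums are taken in this topology.\<close>

definition cts_into ::
    "('n \<Rightarrow> complex) set \<Rightarrow> (('n \<Rightarrow> complex) \<Rightarrow> real) set \<Rightarrow> ('v::real_normed_vector \<Rightarrow> 'n \<Rightarrow> complex) \<Rightarrow> bool"
  where
  "cts_into A P F \<longleftrightarrow>
     (\<forall>v. F v \<in> A) \<and> (\<forall>p\<in>P. \<forall>v. ((\<lambda>w. p (\<lambda>x. F w x - F v x)) \<longlongrightarrow> 0) (at v))"

definition has_partial ::
    "('n \<Rightarrow> complex) set \<Rightarrow> (('n \<Rightarrow> complex) \<Rightarrow> real) set \<Rightarrow> ('v::real_normed_vector \<Rightarrow> 'n \<Rightarrow> complex)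
      \<Rightarrow> 'v \<Rightarrow> 'v \<Rightarrow> ('n \<Rightarrow> complex) \<Rightarrow> bool" where
  "has_partial A P F b v g \<longleftrightarrow>
     g \<in> A \<and>
     (\<forall>p\<in>P. ((\<lambda>t. p (\<lambda>x. (F (v + t *\<^sub>R b) x - F v x) / of_real t - g x)) \<longlongrightarrow> 0) (at (0::real)))"

definition partial ::
    "('n \<Rightarrow> complex) set \<Rightarrow> (('n \<Rightarrow> complex) \<Rightarrow> real) set \<Rightarrow> 'v \<Rightarrow> ('v::real_normed_vector \<Rightarrow> 'n \<Rightarrow> complex)
      \<Rightarrow> 'v \<Rightarrow> 'n \<Rightarrow> complex" where
  "partial A P b F v =
     (if \<exists>!g. has_partial A P F b v g then (THE g. has_partial A P F b v g) else (\<lambda>x. 0))"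

definition partials ::
    "('n \<Rightarrow> complex) set \<Rightarrow> (('n \<Rightarrow> complex) \<Rightarrow> real) set \<Rightarrow> 'v list \<Rightarrow> ('v::real_normed_vector \<Rightarrow> 'n \<Rightarrow> complex)
      \<Rightarrow> 'v \<Rightarrow> 'n \<Rightarrow> complex" where
  "partials A P bs F = foldr (partial A P) bs F"

definition smooth_into ::
    "('n \<Rightarrow> complex) set \<Rightarrow> (('n \<Rightarrow> complex) \<Rightarrow> real) set \<Rightarrow> ('v::euclidean_space \<Rightarrow> 'n \<Rightarrow> complex) \<Rightarrow> bool"
  where
  "smooth_into A P F \<longleftrightarrow>
     (\<forall>bs. set bs \<subseteq> Basis \<longrightarrow>
        cts_into A P (partials A P bs F) \<and>
        (\<forall>b\<in>Basis. \<forall>v. \<exists>g. has_partial A P (partials A P bs F) b v g))"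

definition smooth_vectors ::
    "('n \<Rightarrow> complex) set \<Rightarrow> (('n \<Rightarrow> complex) \<Rightarrow> real) set
      \<Rightarrow> ('v::euclidean_space \<Rightarrow> ('n \<Rightarrow> complex) \<Rightarrow> 'n \<Rightarrow> complex) \<Rightarrow> ('n \<Rightarrow> complex) set" where
  "smooth_vectors A P \<alpha> = {a \<in> A. smooth_into A P (\<lambda>v. \<alpha> v a)}"

text \<open>The (Henstock-Kurzweil) integral of \<^term>\<open>A\<close>-valued functions, as for Banach space valued
  functions in the library, with the norm replaced by the seminorms in \<^term>\<open>P\<close>. For
  continuous functions on a box it is the Riemann integral.\<close>

definition has_integral_box ::
    "('n \<Rightarrow> complex) set \<Rightarrow> (('n \<Rightarrow> complex) \<Rightarrow> real) set \<Rightarrow> ('v::euclidean_space \<Rightarrow> 'n \<Rightarrow> complex)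
      \<Rightarrow> ('n \<Rightarrow> complex) \<Rightarrow> 'v \<Rightarrow> 'v \<Rightarrow> bool" where
  "has_integral_box A P F I a b \<longleftrightarrow>
     I \<in> A \<and>
     (\<forall>p\<in>P. ((\<lambda>D. p (\<lambda>x. (\<Sum>(z, K)\<in>D. measure lborel K *\<^sub>R F z x) - I x)) \<longlongrightarrow> 0) (division_filter (cbox a b)))"

definition has_integral_into ::
    "('n \<Rightarrow> complex) set \<Rightarrow> (('n \<Rightarrow> complex) \<Rightarrow> real) set \<Rightarrow> ('v::euclidean_space \<Rightarrow> 'n \<Rightarrow> complex)
      \<Rightarrow> ('n \<Rightarrow> complex) \<Rightarrow> bool" where
  "has_integral_into A P F I \<longleftrightarrow>
     I \<in> A \<and>
     (\<forall>p\<in>P. \<forall>e>0. \<exists>B>0. \<forall>a b. ball 0 B \<subseteq> cbox a b \<longrightarrow>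
        (\<exists>J. has_integral_box A P F J a b \<and> p (\<lambda>x. J x - I x) < e))"

definition integral_into ::
    "('n \<Rightarrow> complex) set \<Rightarrow> (('n \<Rightarrow> complex) \<Rightarrow> real) set \<Rightarrow> ('v::euclidean_space \<Rightarrow> 'n \<Rightarrow> complex)
      \<Rightarrow> 'n \<Rightarrow> complex" where
  "integral_into A P F =
     (if \<exists>!I. has_integral_into A P F I then (THE I. has_integral_into A P F I) else (\<lambda>x. 0))"

definition lattice_in :: "'v::euclidean_space set \<Rightarrow> bool" where
  "lattice_in \<Lambda> \<longleftrightarrow>
     (\<exists>B. independent B \<and> span B = UNIV \<and> \<Lambda> = {\<Sum>b\<in>B. of_int (n b) *\<^sub>R b | n :: 'v \<Rightarrow> int. True})"

text \<open>The translates of \<^term>\<open>\<rho>\<close> by \<^term>\<open>\<Lambda>\<close> are a smooth partition of unity.\<close>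

definition lattice_partition_of_unity ::
    "'v::euclidean_space set \<Rightarrow> ('v \<Rightarrow> real) \<Rightarrow> bool" where
  "lattice_partition_of_unity \<Lambda> \<rho> \<longleftrightarrow>
     lattice_in \<Lambda> \<and> smooth_on UNIV \<rho> \<and> bounded {z. \<rho> z \<noteq> 0} \<and> (\<forall>z. 0 \<le> \<rho> z) \<and>
     (\<forall>z. ((\<lambda>w. \<rho> (z - w)) has_sum 1) \<Lambda>)"

text \<open>The oscillatory integral is independent of the partition of unity, so it is required to be
  the value for all of them. The sum over the lattice is unconditional.\<close>

definition has_osc_integral ::
    "('n \<Rightarrow> complex) set \<Rightarrow> (('n \<Rightarrow> complex) \<Rightarrow> real) set \<Rightarrow> ((real^'d) \<times> (real^'d) \<Rightarrow> 'n \<Rightarrow> complex)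
      \<Rightarrow> ('n \<Rightarrow> complex) \<Rightarrow> bool" where
  "has_osc_integral A P F I \<longleftrightarrow>
     I \<in> A \<and>
     (\<forall>\<Lambda> \<rho>. lattice_partition_of_unity \<Lambda> \<rho> \<longrightarrow>
        (\<exists>J. (\<forall>w\<in>\<Lambda>. has_integral_into A P
                (\<lambda>(u, v) x. F (u, v) x * of_real (\<rho> ((u, v) - w)) * cis (2 * pi * (u \<bullet> v))) (J w)) \<and>
             (\<forall>p\<in>P. ((\<lambda>W. p (\<lambda>x. (\<Sum>w\<in>W. J w x) - I x)) \<longlongrightarrow> 0) (finite_subsets_at_top \<Lambda>))))"

definition osc_integral ::
    "('n \<Rightarrow> complex) set \<Rightarrow> (('n \<Rightarrow> complex) \<Rightarrow> real) set \<Rightarrow> ((real^'d) \<times> (real^'d) \<Rightarrow> 'n \<Rightarrow> complex)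
      \<Rightarrow> 'n \<Rightarrow> complex" where
  "osc_integral A P F =
     (if \<exists>!I. has_osc_integral A P F I then (THE I. has_osc_integral A P F I) else (\<lambda>x. 0))"


section \<open>The deformed product and the deformed topology\<close>

definition deformed_product ::
    "('n \<Rightarrow> complex) set \<Rightarrow> (('n \<Rightarrow> complex) \<Rightarrow> real) set \<Rightarrow> (real^'d \<Rightarrow> ('n \<Rightarrow> complex) \<Rightarrow> 'n \<Rightarrow> complex)
      \<Rightarrow> real^'d^'d \<Rightarrow> ('n \<Rightarrow> complex) \<Rightarrow> ('n \<Rightarrow> complex) \<Rightarrow> 'n \<Rightarrow> complex" where
  "deformed_product A P \<alpha> \<Theta> a b = osc_integral A P (\<lambda>(u, v) x. \<alpha> (\<Theta> *v u) a x * \<alpha> v b x)"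

text \<open>The bounded uniformly continuous functions from \<open>real^'d\<close> to \<^term>\<open>A\<close>, in uncurried form,
  so that the notions of the previous section apply to them.\<close>

definition Cu :: "('n \<Rightarrow> complex) set \<Rightarrow> (('n \<Rightarrow> complex) \<Rightarrow> real) set \<Rightarrow> ((real^'d) \<times> 'n \<Rightarrow> complex) set"
  where
  "Cu A P =
     {F. (\<forall>v. curry F v \<in> A) \<and> (\<forall>p\<in>P. bounded (range (\<lambda>v. p (curry F v)))) \<and>
         (\<forall>p\<in>P. \<forall>e>0. \<exists>d>0. \<forall>v w. dist v w < d \<longrightarrow> p (\<lambda>x. F (v, x) - F (w, x)) < e)}"

definition Cu_seminorms ::
    "(('n \<Rightarrow> complex) \<Rightarrow> real) set \<Rightarrow> (((real^'d) \<times> 'n \<Rightarrow> complex) \<Rightarrow> real) set" where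
  "Cu_seminorms P = (\<lambda>p F. SUP v. p (curry F v)) ` P"

definition translation :: "real^'d \<Rightarrow> ((real^'d) \<times> 'n \<Rightarrow> complex) \<Rightarrow> (real^'d) \<times> 'n \<Rightarrow> complex" where
  "translation w F = (\<lambda>(v, x). F (v + w, x))"

definition Cu_product ::
    "('n \<Rightarrow> complex) set \<Rightarrow> (('n \<Rightarrow> complex) \<Rightarrow> real) set \<Rightarrow> real^'d^'d
      \<Rightarrow> (real^'d \<Rightarrow> 'n \<Rightarrow> complex) \<Rightarrow> (real^'d \<Rightarrow> 'n \<Rightarrow> complex) \<Rightarrow> real^'d \<Rightarrow> 'n \<Rightarrow> complex" where
  "Cu_product A P \<Theta> F G y = osc_integral A P (\<lambda>(u, v) x. F (y + \<Theta> *v u) x * G (y + v) x)"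

definition schwartz_into ::
    "('n \<Rightarrow> complex) set \<Rightarrow> (('n \<Rightarrow> complex) \<Rightarrow> real) set \<Rightarrow> (real^'d \<Rightarrow> 'n \<Rightarrow> complex) set" where
  "schwartz_into A P =
     {f. case_prod f \<in> smooth_vectors (Cu A P) (Cu_seminorms P) translation \<and>
         (\<forall>bs r. set bs \<subseteq> Basis \<and> real_polynomial_function r \<longrightarrow>
            (\<forall>p\<in>P. bounded (range (\<lambda>v. r v * p (partials A P bs f v)))))}"

definition schwartz_norm ::
    "('n \<Rightarrow> complex) set \<Rightarrow> (('n \<Rightarrow> complex) \<Rightarrow> real) set \<Rightarrow> (('n \<Rightarrow> complex) \<Rightarrow> real)
      \<Rightarrow> (real^'d \<Rightarrow> 'n \<Rightarrow> complex) \<Rightarrow> real" where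
  "schwartz_norm A P q f = sqrt (q (integral_into A P (\<lambda>v x. cnj (f v x) * f v x)))"

definition deformed_seminorm ::
    "('n \<Rightarrow> complex) set \<Rightarrow> (('n \<Rightarrow> complex) \<Rightarrow> real) set \<Rightarrow> (real^'d \<Rightarrow> ('n \<Rightarrow> complex) \<Rightarrow> 'n \<Rightarrow> complex)
      \<Rightarrow> real^'d^'d \<Rightarrow> (('n \<Rightarrow> complex) \<Rightarrow> real) \<Rightarrow> ('n \<Rightarrow> complex) \<Rightarrow> real" where
  "deformed_seminorm A P \<alpha> \<Theta> q a =
     Sup {schwartz_norm A P q (Cu_product A P \<Theta> (\<lambda>v. \<alpha> v a) g) | g.
          g \<in> schwartz_into A P \<and> schwartz_norm A P q g \<le> 1}"

definition cstar_seminorms ::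
    "('n \<Rightarrow> complex) set \<Rightarrow> (('n \<Rightarrow> complex) \<Rightarrow> real) set \<Rightarrow> (('n \<Rightarrow> complex) \<Rightarrow> real) set" where
  "cstar_seminorms A P =
     {q. (\<forall>a\<in>A. 0 \<le> q a) \<and>
         (\<forall>a\<in>A. \<forall>z. q (\<lambda>x. z * a x) = norm z * q a) \<and>
         (\<forall>a\<in>A. \<forall>b\<in>A. q (\<lambda>x. a x + b x) \<le> q a + q b) \<and>
         (\<forall>a\<in>A. \<forall>b\<in>A. q (\<lambda>x. a x * b x) \<le> q a * q b) \<and>
         (\<forall>a\<in>A. q (\<lambda>x. cnj (a x) * a x) = (q a)\<^sup>2) \<and>
         (\<exists>Q C. finite Q \<and> Q \<subseteq> P \<and> (\<forall>a\<in>A. q a \<le> C * (\<Sum>p\<in>Q. p a)))}"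

definition seminorm_topology ::
    "('n \<Rightarrow> complex) set \<Rightarrow> (('n \<Rightarrow> complex) \<Rightarrow> real) set \<Rightarrow> ('n \<Rightarrow> complex) topology" where
  "seminorm_topology E Q = topology (\<lambda>S. S \<subseteq> E \<and>
     (\<forall>a\<in>S. \<exists>R e. finite R \<and> R \<subseteq> Q \<and> e > 0 \<and>
        (\<forall>b\<in>E. (\<forall>q\<in>R. q (\<lambda>x. b x - a x) < e) \<longrightarrow> b \<in> S)))"

lemma openin_seminorm_topology:
  "openin (seminorm_topology E Q) S \<longleftrightarrow> S \<subseteq> E \<and>
     (\<forall>a\<in>S. \<exists>R e. finite R \<and> R \<subseteq> Q \<and> e > 0 \<and>
        (\<forall>b\<in>E. (\<forall>q\<in>R. q (\<lambda>x. b x - a x) < e) \<longrightarrow> b \<in> S))"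
proof -
  define nb where "nb a R e S \<longleftrightarrow> finite R \<and> R \<subseteq> Q \<and> (e::real) > 0 \<and>
      (\<forall>b\<in>E. (\<forall>q\<in>R. q (\<lambda>x. b x - a x) < e) \<longrightarrow> b \<in> S)" for a R e S
  have "istopology (\<lambda>S. S \<subseteq> E \<and> (\<forall>a\<in>S. \<exists>R e. nb a R e S))"
    unfolding istopology_def
  proof (intro conjI allI impI)
    fix S T assume S: "S \<subseteq> E \<and> (\<forall>a\<in>S. \<exists>R e. nb a R e S)" and T: "T \<subseteq> E \<and> (\<forall>a\<in>T. \<exists>R e. nb a R e T)"
    show "S \<inter> T \<subseteq> E" using S by blast
    show "\<forall>a\<in>S \<inter> T. \<exists>R e. nb a R e (S \<inter> T)"
    proof
      fix a assume "a \<in> S \<inter> T"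
      then obtain R e R' e' where "nb a R e S" "nb a R' e' T" using S T by blast
      then have "nb a (R \<union> R') (min e e') (S \<inter> T)" unfolding nb_def by auto
      then show "\<exists>R e. nb a R e (S \<inter> T)" by blast
    qed
  next
    fix K assume K: "\<forall>S\<in>K. S \<subseteq> E \<and> (\<forall>a\<in>S. \<exists>R e. nb a R e S)"
    show "\<Union>K \<subseteq> E" using K by blast
    show "\<forall>a\<in>\<Union>K. \<exists>R e. nb a R e (\<Union>K)"
    proof
      fix a assume "a \<in> \<Union>K"
      then obtain S R e where "S \<in> K" "nb a R e S" using K by blast
      then have "nb a R e (\<Union>K)" unfolding nb_def by blast
      then show "\<exists>R e. nb a R e (\<Union>K)" by blast
    qed
  qed
  then show ?thesis
    unfolding seminorm_topology_def nb_def by (simp add: topology_inverse')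
qed

text \<open>The topology on the smooth vectors defined by the deformed seminorms of all \<^term>\<open>q\<close> in
  \<^term>\<open>Q\<close>: all continuous C*-seminorms for a pro-C*-algebra, only the C*-norm for a
  C*-algebra.\<close>

definition deformed_topology ::
    "('n \<Rightarrow> complex) set \<Rightarrow> (('n \<Rightarrow> complex) \<Rightarrow> real) set \<Rightarrow> (real^'d \<Rightarrow> ('n \<Rightarrow> complex) \<Rightarrow> 'n \<Rightarrow> complex)
      \<Rightarrow> real^'d^'d \<Rightarrow> (('n \<Rightarrow> complex) \<Rightarrow> real) set \<Rightarrow> ('n \<Rightarrow> complex) topology" where
  "deformed_topology A P \<alpha> \<Theta> Q =
     seminorm_topology (smooth_vectors A P \<alpha>) (deformed_seminorm A P \<alpha> \<Theta> ` Q)"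

definition star_isomorphism ::
    "('n \<Rightarrow> complex) set \<Rightarrow> (('n \<Rightarrow> complex) \<Rightarrow> ('n \<Rightarrow> complex) \<Rightarrow> 'n \<Rightarrow> complex)
      \<Rightarrow> ('k \<Rightarrow> complex) set \<Rightarrow> (('k \<Rightarrow> complex) \<Rightarrow> ('k \<Rightarrow> complex) \<Rightarrow> 'k \<Rightarrow> complex)
      \<Rightarrow> (('n \<Rightarrow> complex) \<Rightarrow> 'k \<Rightarrow> complex) \<Rightarrow> bool" where
  "star_isomorphism A prodA B prodB F \<longleftrightarrow>
     bij_betw F A B \<and>
     (\<forall>a\<in>A. \<forall>b\<in>A. F (\<lambda>x. a x + b x) = (\<lambda>y. F a y + F b y)) \<and>
     (\<forall>z. \<forall>a\<in>A. F (\<lambda>x. z * a x) = (\<lambda>y. z * F a y)) \<and>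
     (\<forall>a\<in>A. \<forall>b\<in>A. F (prodA a b) = prodB (F a) (F b)) \<and>
     (\<forall>a\<in>A. F (\<lambda>x. cnj (a x)) = (\<lambda>y. cnj (F a y)))"

end

theory Submission
  imports Defs
begin

text \<open>
  The deformed product, the smooth vectors and the deformed topology of a function algebra are
  built from three things only: the algebra, its defining seminorms, and the action of
  \<open>\<real>\<^sup>d\<close>. A pull-back that matches all three therefore matches everything built from
  them, and the theorem reduces to checking the three.

  The first part makes this precise. In the locale \<open>function_transport\<close> the pull-back along an
  injection maps one algebra onto another, and the seminorms of the first are those of the second
  composed with the pull-back. Each notion of the construction is the existence, or the unique
  choice, of functions that satisfy conditions expressed by pointwise operations and by seminorms,
  so its solutions on the one side are exactly the pull-backs of its solutions on the other. This
  goes from derivatives and integrals through oscillatory integrals and Schwartz functions up to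
  the deformed seminorms; \<open>transport_deformation\<close> collects the result.

  Since \<open>\<Phi>\<close> is a homeomorphism from \<open>\<U>\<close> to \<open>\<V>\<close>, the pull-back matches the continuous functions,
  the bounded ones and those vanishing at infinity. Compact subsets correspond as well, and with
  them the seminorms.

  The geometric content is that the pull-back intertwines the two actions, for which the flows of
  \<open>X\<^sub>i\<close> and \<open>\<Phi>\<^sub>* X\<^sub>i\<close> must correspond. An integral curve of \<open>X\<^sub>i\<close> that starts in \<open>\<U>\<close>
  stays there: outside \<open>\<U>\<close> it is off the closed support of \<open>X\<^sub>i\<close>, so it is locally constant, and the times
  it spends inside and outside \<open>\<U>\<close> are two open sets that cover the connected real line. By the
  chain rule \<open>\<Phi>\<close> maps the integral curves in \<open>\<U>\<close> to those of \<open>\<Phi>\<^sub>* X\<^sub>i\<close> in \<open>\<V>\<close>, and its inverse maps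
  these back. Hence the integral curves from a point and from its image are in bijection, and the
  flows correspond.
\<close>

section \<open>Continuity for topologies of seminorms\<close>

text \<open>Each seminorm of a difference of images is a seminorm of the difference, so a basic
  neighbourhood of an image is the image of a basic neighbourhood of the same radius.\<close>

lemma continuous_map_pullback_seminorms:
  assumes "\<And>s. s \<in> S \<Longrightarrow> \<exists>s'\<in>R. \<forall>a b. s (\<lambda>x. T b x - T a x) = s' (\<lambda>x. b x - a x)"
  shows "continuous_map (seminorm_topology E R) (seminorm_topology (T ` E) S) T"
proof -
  have topspace: "topspace (seminorm_topology E' R') = E'" for E' :: "('c \<Rightarrow> complex) set" and R'
  proof -
    have "\<exists>R0 e. finite R0 \<and> R0 \<subseteq> R' \<and> e > 0 \<and>
        (\<forall>b\<in>E'. (\<forall>q\<in>R0. q (\<lambda>x. b x - a x) < e) \<longrightarrow> b \<in> E')" for a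
      by (intro exI[of _ "{}"] exI[of _ "1::real"]) auto
    then have "openin (seminorm_topology E' R') E'" unfolding openin_seminorm_topology by blast
    moreover have "topspace (seminorm_topology E' R') \<subseteq> E'"
      using openin_topspace[of "seminorm_topology E' R'"] unfolding openin_seminorm_topology by blast
    ultimately show ?thesis using openin_subset by blast
  qed
  obtain f where f: "\<And>s. s \<in> S \<Longrightarrow> f s \<in> R"
    "\<And>s a b. s \<in> S \<Longrightarrow> s (\<lambda>x. T b x - T a x) = f s (\<lambda>x. b x - a x)"
    using assms by metis
  show ?thesis
    unfolding continuous_map_def topspace
  proof (intro conjI allI impI)
    fix W assume W: "openin (seminorm_topology (T ` E) S) W"
    have "\<exists>R0 e. finite R0 \<and> R0 \<subseteq> R \<and> e > 0 \<and>
        (\<forall>b\<in>E. (\<forall>q\<in>R0. q (\<lambda>x. b x - a x) < e) \<longrightarrow> b \<in> {x \<in> E. T x \<in> W})"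
      if a: "a \<in> E" "T a \<in> W" for a
    proof -
      obtain S0 e where S0: "finite S0" "S0 \<subseteq> S" "e > 0"
        "\<forall>b\<in>T ` E. (\<forall>q\<in>S0. q (\<lambda>x. b x - T a x) < e) \<longrightarrow> b \<in> W"
        using W a(2) unfolding openin_seminorm_topology by blast
      then show ?thesis
        using f by (intro exI[of _ "f ` S0"] exI[of _ e]) (auto simp: subset_iff)
    qed
    then show "openin (seminorm_topology E R) {x \<in> E. T x \<in> W}"
      unfolding openin_seminorm_topology by blast
  qed auto
qed

section \<open>Transport of analysis along a pull-back\<close>

text \<open>The condition \<open>seminorms\<close> says that \<open>P\<close> consists of the seminorms in \<open>Q\<close> composed with the
  pull-back, on all functions and not only on those in \<open>A\<close>; difference quotients and Riemann sums
  that are not known to lie in \<open>A\<close> are thus covered. On functions that vanish off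
  \<open>\<phi> ` K\<close> the pull-back is injective.\<close>

locale function_transport =
  fixes K :: "'k set" and \<phi> :: "'k \<Rightarrow> 'n"
    and A :: "('n \<Rightarrow> complex) set" and P :: "(('n \<Rightarrow> complex) \<Rightarrow> real) set"
    and B :: "('k \<Rightarrow> complex) set" and Q :: "(('k \<Rightarrow> complex) \<Rightarrow> real) set"
  assumes inj: "inj_on \<phi> K"
    and vanishing: "f \<in> A \<Longrightarrow> x \<notin> \<phi> ` K \<Longrightarrow> f x = 0"
    and image: "B = pullback K \<phi> ` A"
    and seminorms: "P = (\<lambda>q f. q (pullback K \<phi> f)) ` Q"
begin

abbreviation T where "T \<equiv> pullback K \<phi>"

abbreviation supported where "supported f \<equiv> \<forall>x. x \<notin> \<phi> ` K \<longrightarrow> f x = 0"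

lemma ball_seminorms: "(\<forall>p\<in>P. R p) \<longleftrightarrow> (\<forall>q\<in>Q. R (\<lambda>f. q (T f)))"
  by (simp add: seminorms)

lemma pullback_zero: "T (\<lambda>x. 0) = (\<lambda>x. 0)"
  by (simp add: pullback_def fun_eq_iff)

lemma pullback_inject:
  assumes "supported f" "supported g" "T f = T g"
  shows "f = g"
proof
  fix x show "f x = g x"
  proof (cases "x \<in> \<phi> ` K")
    case True
    then obtain y where "y \<in> K" "x = \<phi> y" by blast
    then show ?thesis using fun_cong[OF assms(3), of y] by (simp add: pullback_def)
  qed (use assms in auto)
qed

lemma inj_on_pullback: "inj_on T A"
  using pullback_inject vanishing by (meson inj_onI)

lemma pullback_mem_iff:
  assumes "supported f"
  shows "T f \<in> B \<longleftrightarrow> f \<in> A"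
  using pullback_inject[OF assms] vanishing unfolding image by blast

text \<open>Derivatives, integrals and oscillatory integrals are each chosen as the unique solution of a
  condition, or as 0. If the solutions on the one side are the pull-backs of those on the other,
  uniqueness holds on both sides or on neither, and the chosen values correspond.\<close>

lemma pullback_unique_choice:
  assumes "\<And>h. R' h \<longleftrightarrow> (\<exists>g. h = T g \<and> R g)" and "\<And>g. R g \<Longrightarrow> g \<in> A"
  shows "(if \<exists>!h. R' h then THE h. R' h else (\<lambda>x. 0))
    = T (if \<exists>!g. R g then THE g. R g else (\<lambda>x. 0))"
proof -
  have inj: "g = g'" if "R g" "R g'" "T g = T g'" for g g'
    using that assms(2) inj_on_pullback by (auto dest: inj_onD)
  have iff: "(\<exists>!h. R' h) \<longleftrightarrow> (\<exists>!g. R g)"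
    unfolding assms(1) using inj by metis
  show ?thesis
  proof (cases "\<exists>!g. R g")
    case True
    then obtain g where g: "R g" "\<And>g'. R g' \<Longrightarrow> g' = g" by blast
    have "(THE g. R g) = g" using g by blast
    moreover have "(THE h. R' h) = T g" using g unfolding assms(1) by blast
    ultimately show ?thesis using True iff by simp
  qed (use iff pullback_zero in simp)
qed

lemma has_partial_pullback:
  "has_partial B Q (\<lambda>v. T (F v)) b v h \<longleftrightarrow> (\<exists>g. h = T g \<and> has_partial A P F b v g)"
proof -
  have eq: "(\<lambda>x. (T (F (v + t *\<^sub>R b)) x - T (F v) x) / of_real t - T g x)
      = T (\<lambda>x. (F (v + t *\<^sub>R b) x - F v x) / of_real t - g x)" for t g
    by (auto simp: pullback_def fun_eq_iff)
  have "has_partial B Q (\<lambda>v. T (F v)) b v (T g) \<longleftrightarrow> has_partial A P F b v g" if "g \<in> A" for g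
    using that unfolding has_partial_def eq by (simp add: seminorms image)
  moreover have "h \<in> T ` A" if "has_partial B Q (\<lambda>v. T (F v)) b v h"
    using that by (simp add: has_partial_def image)
  moreover have "g \<in> A" if "has_partial A P F b v g" for g
    using that by (simp add: has_partial_def)
  ultimately show ?thesis by blast
qed

lemma partial_pullback: "partial B Q b (\<lambda>v. T (F v)) = (\<lambda>v. T (partial A P b F v))"
  unfolding partial_def
  by (rule ext, rule pullback_unique_choice[OF has_partial_pullback]) (simp add: has_partial_def)

lemma partials_pullback: "partials B Q bs (\<lambda>v. T (F v)) = (\<lambda>v. T (partials A P bs F v))"
  by (induction bs) (simp_all add: partials_def partial_pullback)

lemma partials_supported:
  assumes "\<And>v. supported (F v)"
  shows "supported (partials A P bs F v)"
proof (cases bs)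
  case (Cons b bs')
  have "has_partial A P G b v (THE g. has_partial A P G b v g)" if "\<exists>!g. has_partial A P G b v g" for G
    using that by (rule theI')
  then have "partial A P b G v \<in> A \<or> partial A P b G v = (\<lambda>x. 0)" for G
    by (auto simp: partial_def has_partial_def)
  then have "supported (partial A P b G v)" for G
    using vanishing by metis
  then show ?thesis
    unfolding Cons partials_def foldr_Cons comp_apply .
qed (use assms in \<open>simp add: partials_def\<close>)

lemma cts_into_pullback:
  assumes "\<And>v. supported (F v)"
  shows "cts_into B Q (\<lambda>v. T (F v)) \<longleftrightarrow> cts_into A P F"
proof -
  have "(\<lambda>x. T (F w) x - T (F v) x) = T (\<lambda>x. F w x - F v x)" for v w
    by (auto simp: pullback_def fun_eq_iff)
  then show ?thesis
    using pullback_mem_iff assms by (simp add: cts_into_def seminorms)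
qed

lemma smooth_into_pullback:
  assumes "\<And>v. supported (F v)"
  shows "smooth_into B Q (\<lambda>v. T (F v)) \<longleftrightarrow> smooth_into A P F"
  unfolding smooth_into_def partials_pullback
  using cts_into_pullback partials_supported[of F, OF assms] has_partial_pullback by metis

lemma smooth_vectors_pullback:
  assumes "\<And>v a. a \<in> A \<Longrightarrow> \<beta> v (T a) = T (\<alpha> v a)"
    and "\<And>v a. a \<in> A \<Longrightarrow> supported (\<alpha> v a)"
  shows "smooth_vectors B Q \<beta> = T ` smooth_vectors A P \<alpha>"
proof -
  have "T a \<in> smooth_vectors B Q \<beta> \<longleftrightarrow> a \<in> smooth_vectors A P \<alpha>" if "a \<in> A" for a
    using smooth_into_pullback[of "\<lambda>v. \<alpha> v a"] assms that image by (simp add: smooth_vectors_def)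
  moreover have "smooth_vectors B Q \<beta> \<subseteq> T ` A" "smooth_vectors A P \<alpha> \<subseteq> A"
    by (auto simp: smooth_vectors_def image)
  ultimately show ?thesis by blast
qed

text \<open>Riemann sums are finite linear combinations of values, so the pull-back commutes with them.\<close>

lemma has_integral_box_pullback:
  "has_integral_box B Q (\<lambda>z. T (F z)) h a b \<longleftrightarrow> (\<exists>g. h = T g \<and> has_integral_box A P F g a b)"
proof -
  have eq: "(\<lambda>x. (\<Sum>(z, k)\<in>D. measure lborel k *\<^sub>R T (F z) x) - T g x)
      = T (\<lambda>x. (\<Sum>(z, k)\<in>D. measure lborel k *\<^sub>R F z x) - g x)" for D g
    by (auto simp: pullback_def fun_eq_iff)
  have "has_integral_box B Q (\<lambda>z. T (F z)) (T g) a b \<longleftrightarrow> has_integral_box A P F g a b" if "g \<in> A" for g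
    using that unfolding has_integral_box_def eq by (simp add: seminorms image)
  moreover have "h \<in> T ` A" if "has_integral_box B Q (\<lambda>z. T (F z)) h a b"
    using that by (simp add: has_integral_box_def image)
  moreover have "g \<in> A" if "has_integral_box A P F g a b" for g
    using that by (simp add: has_integral_box_def)
  ultimately show ?thesis by blast
qed

lemma has_integral_into_pullback:
  "has_integral_into B Q (\<lambda>z. T (F z)) h \<longleftrightarrow> (\<exists>g. h = T g \<and> has_integral_into A P F g)"
proof -
  have eq: "(\<lambda>x. T j x - T g x) = T (\<lambda>x. j x - g x)" for j g
    by (auto simp: pullback_def fun_eq_iff)
  have "has_integral_into B Q (\<lambda>z. T (F z)) (T g) \<longleftrightarrow> has_integral_into A P F g" if "g \<in> A" for g
  proof -
    have witness: "(\<exists>J. (\<exists>g. J = T g \<and> H g) \<and> R J) \<longleftrightarrow> (\<exists>g. H g \<and> R (T g))" for H R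
      by blast
    have "T g \<in> B" using that image by blast
    then show ?thesis
      using that
      unfolding has_integral_into_def ball_seminorms has_integral_box_pullback witness eq by simp
  qed
  moreover have "h \<in> T ` A" if "has_integral_into B Q (\<lambda>z. T (F z)) h"
    using that by (simp add: has_integral_into_def image)
  moreover have "g \<in> A" if "has_integral_into A P F g" for g
    using that by (simp add: has_integral_into_def)
  ultimately show ?thesis by blast
qed

lemma integral_into_pullback: "integral_into B Q (\<lambda>z. T (F z)) = T (integral_into A P F)"
  unfolding integral_into_def
  by (rule pullback_unique_choice[OF has_integral_into_pullback]) (simp add: has_integral_into_def)

lemma has_osc_integral_pullback:
  fixes F :: "(real^'d) \<times> (real^'d) \<Rightarrow> 'n \<Rightarrow> complex"
  shows "has_osc_integral B Q (\<lambda>z. T (F z)) h \<longleftrightarrow> (\<exists>g. h = T g \<and> has_osc_integral A P F g)"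
proof -
  define G where "G = (\<lambda>\<rho> w z x. F z x * of_real (\<rho> (z - w)) * cis (2 * pi * (fst z \<bullet> snd z)))"
  have G: "(\<lambda>(u, v) x. F (u, v) x * of_real (\<rho> ((u, v) - w)) * cis (2 * pi * (u \<bullet> v))) = G \<rho> w"
    for \<rho> w by (auto simp: G_def fun_eq_iff)
  have TG: "(\<lambda>(u, v) x. T (F (u, v)) x * of_real (\<rho> ((u, v) - w)) * cis (2 * pi * (u \<bullet> v)))
      = (\<lambda>z. T (G \<rho> w z))" for \<rho> w
    by (auto simp: G_def pullback_def fun_eq_iff)
  have eq: "(\<lambda>x. (\<Sum>w\<in>W. T (J w) x) - T g x) = T (\<lambda>x. (\<Sum>w\<in>W. J w x) - g x)"
    for J :: "_ \<Rightarrow> _" and W g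
    by (auto simp: pullback_def fun_eq_iff)
  have "has_osc_integral B Q (\<lambda>z. T (F z)) (T g) \<longleftrightarrow> has_osc_integral A P F g" if "g \<in> A" for g
  proof -
    have "(\<exists>J. (\<forall>w\<in>\<Lambda>. has_integral_into B Q (\<lambda>z. T (G \<rho> w z)) (J w)) \<and>
             (\<forall>q\<in>Q. ((\<lambda>W. q (\<lambda>x. (\<Sum>w\<in>W. J w x) - T g x)) \<longlongrightarrow> 0) (finite_subsets_at_top \<Lambda>)))
      \<longleftrightarrow> (\<exists>J. (\<forall>w\<in>\<Lambda>. has_integral_into A P (G \<rho> w) (J w)) \<and>
             (\<forall>q\<in>Q. ((\<lambda>W. q (T (\<lambda>x. (\<Sum>w\<in>W. J w x) - g x))) \<longlongrightarrow> 0) (finite_subsets_at_top \<Lambda>)))"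
      (is "?l = ?r") for \<Lambda> \<rho>
    proof
      assume ?l
      then obtain J where J: "\<forall>w\<in>\<Lambda>. has_integral_into B Q (\<lambda>z. T (G \<rho> w z)) (J w)"
        "\<forall>q\<in>Q. ((\<lambda>W. q (\<lambda>x. (\<Sum>w\<in>W. J w x) - T g x)) \<longlongrightarrow> 0) (finite_subsets_at_top \<Lambda>)"
        by blast
      \<comment> \<open>The terms \<open>J w\<close> are determined only for \<open>w\<close> in the lattice, so the sums over \<open>J\<close> and over the
        pull-backs of \<open>J'\<close> agree only on its finite subsets.\<close>
      from J(1) obtain J' where J': "\<forall>w\<in>\<Lambda>. J w = T (J' w) \<and> has_integral_into A P (G \<rho> w) (J' w)"
        unfolding has_integral_into_pullback by metis
      have "\<forall>\<^sub>F W in finite_subsets_at_top \<Lambda>. (\<lambda>x. (\<Sum>w\<in>W. J w x) - T g x)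
          = T (\<lambda>x. (\<Sum>w\<in>W. J' w x) - g x)"
      proof (rule eventually_finite_subsets_at_top_weakI)
        fix W assume "W \<subseteq> \<Lambda>"
        then have "(\<Sum>w\<in>W. J w x) = (\<Sum>w\<in>W. T (J' w) x)" for x
          using J' by (intro sum.cong) auto
        then show "(\<lambda>x. (\<Sum>w\<in>W. J w x) - T g x) = T (\<lambda>x. (\<Sum>w\<in>W. J' w x) - g x)"
          by (simp add: eq)
      qed
      then have "\<forall>\<^sub>F W in finite_subsets_at_top \<Lambda>. q (\<lambda>x. (\<Sum>w\<in>W. J w x) - T g x)
          = q (T (\<lambda>x. (\<Sum>w\<in>W. J' w x) - g x))" for q :: "_ \<Rightarrow> real"
        by (rule eventually_mono) simp
      then have "((\<lambda>W. q (T (\<lambda>x. (\<Sum>w\<in>W. J' w x) - g x))) \<longlongrightarrow> 0) (finite_subsets_at_top \<Lambda>)"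
        if "q \<in> Q" for q
        using J(2)[rule_format, OF that] by (rule Lim_transform_eventually[rotated])
      then show ?r using J' by blast
    next
      assume ?r
      then obtain J where J: "\<forall>w\<in>\<Lambda>. has_integral_into A P (G \<rho> w) (J w)"
        "\<forall>q\<in>Q. ((\<lambda>W. q (T (\<lambda>x. (\<Sum>w\<in>W. J w x) - g x))) \<longlongrightarrow> 0) (finite_subsets_at_top \<Lambda>)"
        by blast
      show ?l
        using J by (intro exI[of _ "\<lambda>w. T (J w)"]) (auto simp: has_integral_into_pullback eq)
    qed
    then show ?thesis
      using that unfolding has_osc_integral_def G TG by (simp add: seminorms image)
  qed
  moreover have "h \<in> T ` A" if "has_osc_integral B Q (\<lambda>z. T (F z)) h"
    using that by (simp add: has_osc_integral_def image)
  moreover have "g \<in> A" if "has_osc_integral A P F g" for g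
    using that by (simp add: has_osc_integral_def)
  ultimately show ?thesis by blast
qed

lemma osc_integral_pullback: "osc_integral B Q (\<lambda>z. T (F z)) = T (osc_integral A P F)"
  unfolding osc_integral_def
  by (rule pullback_unique_choice[OF has_osc_integral_pullback]) (simp add: has_osc_integral_def)

lemma osc_integral_mult_pullback:
  "osc_integral B Q (\<lambda>(u, v) x. T (F u) x * T (G v) x) = T (osc_integral A P (\<lambda>(u, v) x. F u x * G v x))"
proof -
  have "(\<lambda>(u, v) x. T (F u) x * T (G v) x) = (\<lambda>z. T ((\<lambda>(u, v) x. F u x * G v x) z))"
    by (auto simp: pullback_def fun_eq_iff)
  then show ?thesis by (simp add: osc_integral_pullback)
qed

lemma deformed_product_pullback:
  assumes "\<And>v. \<beta> v (T a) = T (\<alpha> v a)" "\<And>v. \<beta> v (T b) = T (\<alpha> v b)"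
  shows "deformed_product B Q \<beta> \<Theta> (T a) (T b) = T (deformed_product A P \<alpha> \<Theta> a b)"
  unfolding deformed_product_def assms
  by (rule osc_integral_mult_pullback)

lemma Cu_product_pullback:
  "Cu_product B Q \<Theta> (\<lambda>v. T (F v)) (\<lambda>v. T (G v)) y = T (Cu_product A P \<Theta> F G y)"
  unfolding Cu_product_def
  by (rule osc_integral_mult_pullback)

lemma curry_pullback:
  "curry (pullback (UNIV \<times> K) (map_prod id \<phi>) F) v = T (curry F v)"
  by (auto simp: pullback_def fun_eq_iff)

text \<open>Functions from \<open>\<real>\<^sup>d\<close> to \<open>A\<close> are again complex functions, on \<open>\<real>\<^sup>d \<times> 'n\<close>, and the supremum over
  \<open>\<real>\<^sup>d\<close> of a seminorm is compatible with the pull-back by \<open>id \<times> \<phi>\<close>. The uniformly continuous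
  functions are thus an instance of the same situation, which gives their smooth vectors under
  translation.\<close>

lemma Cu_transport:
  "function_transport (UNIV \<times> K) (map_prod id \<phi>)
     (Cu A P :: ((real^'d) \<times> 'n \<Rightarrow> complex) set) (Cu_seminorms P) (Cu B Q) (Cu_seminorms Q)"
proof
  let ?T = "pullback (UNIV \<times> K) (map_prod id \<phi>) :: ((real^'d) \<times> 'n \<Rightarrow> complex) \<Rightarrow> _"
  show "inj_on (map_prod id \<phi>) ((UNIV :: (real^'d) set) \<times> K)"
    using inj by (auto simp: inj_on_def)
  show "F z = 0" if "F \<in> Cu A P" "z \<notin> map_prod id \<phi> ` (UNIV \<times> K)"
    for F :: "(real^'d) \<times> 'n \<Rightarrow> complex" and z
  proof -
    have "curry F (fst z) \<in> A" using that(1) by (simp add: Cu_def)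
    moreover have "snd z \<notin> \<phi> ` K" using that(2) by (cases z) force
    ultimately show ?thesis using vanishing[of "curry F (fst z)" "snd z"] by simp
  qed
  show "Cu_seminorms P = (\<lambda>q F. q (?T F)) ` Cu_seminorms Q"
    by (simp add: Cu_seminorms_def seminorms image_image curry_pullback)
  show "Cu B Q = ?T ` Cu A P"
  proof -
    have iff: "?T F \<in> Cu B Q \<longleftrightarrow> F \<in> Cu A P" if "\<And>v. curry F v \<in> A" for F
    proof -
      have "(\<lambda>x. ?T F (v, x) - ?T F (w, x)) = T (\<lambda>x. F (v, x) - F (w, x))" for v w
        by (auto simp: pullback_def fun_eq_iff)
      then show ?thesis
        using that by (simp add: Cu_def curry_pullback seminorms image del: curry_def)
    qed
    have "\<exists>F. G = ?T F \<and> (\<forall>v. curry F v \<in> A)" if "G \<in> Cu B Q" for G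
    proof -
      have "\<forall>v. \<exists>f\<in>A. curry G v = T f" using that by (auto simp: Cu_def image)
      then obtain f where f: "\<And>v. f v \<in> A" "\<And>v. curry G v = T (f v)" by metis
      have "G = ?T (case_prod f)"
      proof
        fix z show "G z = ?T (case_prod f) z"
          using fun_cong[OF f(2)[of "fst z"], of "snd z"] by (cases z) (simp add: pullback_def)
      qed
      then show ?thesis using f(1) by (intro exI[of _ "case_prod f"]) (simp add: curry_def)
    qed
    moreover have "curry F v \<in> A" if "F \<in> Cu A P" for F and v :: "real^'d"
      using that by (simp add: Cu_def)
    ultimately show ?thesis using iff by blast
  qed
qed

lemma schwartz_into_pullback:
  "(schwartz_into B Q :: (real^'d \<Rightarrow> _) set) = (\<lambda>f v. T (f v)) ` schwartz_into A P"
proof -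
  interpret Cu: function_transport "UNIV \<times> K" "map_prod id \<phi>"
    "Cu A P :: ((real^'d) \<times> 'n \<Rightarrow> complex) set" "Cu_seminorms P" "Cu B Q" "Cu_seminorms Q"
    by (rule Cu_transport)
  have smooth: "smooth_vectors (Cu B Q) (Cu_seminorms Q) translation
      = Cu.T ` smooth_vectors (Cu A P) (Cu_seminorms P) (translation :: real^'d \<Rightarrow> _)"
  proof (rule Cu.smooth_vectors_pullback)
    show "translation v (Cu.T F) = Cu.T (translation v F)" for v F
      by (auto simp: translation_def pullback_def fun_eq_iff)
    show "\<forall>z. z \<notin> map_prod id \<phi> ` (UNIV \<times> K) \<longrightarrow> translation v F z = 0"
      if "F \<in> Cu A P" for v :: "real^'d" and F
    proof (intro allI impI)
      fix z assume z: "z \<notin> map_prod id \<phi> ` ((UNIV :: (real^'d) set) \<times> K)"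
      then have "(fst z + v, snd z) \<notin> map_prod id \<phi> ` (UNIV \<times> K)" by (cases z) force
      then show "translation v F z = 0"
        using Cu.vanishing[OF that] by (simp add: translation_def case_prod_beta)
    qed
  qed
  have case_prod: "Cu.T (case_prod f) = case_prod (\<lambda>v. T (f v))" for f
    by (auto simp: pullback_def fun_eq_iff)
  have decay: "(\<forall>q\<in>Q. bounded (range (\<lambda>v. r v * q (partials B Q bs (\<lambda>v. T (f v)) v))))
      \<longleftrightarrow> (\<forall>p\<in>P. bounded (range (\<lambda>v. r v * p (partials A P bs f v))))"
    for r :: "_ \<Rightarrow> real" and f :: "real^'d \<Rightarrow> _" and bs
    by (simp add: partials_pullback seminorms)
  have iff: "(\<lambda>v. T (f v)) \<in> schwartz_into B Q \<longleftrightarrow> f \<in> schwartz_into A P"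
    if "case_prod f \<in> smooth_vectors (Cu A P) (Cu_seminorms P) translation" for f :: "real^'d \<Rightarrow> _"
    using that unfolding schwartz_into_def mem_Collect_eq decay smooth case_prod[symmetric] by blast
  have "\<exists>f. g = (\<lambda>v. T (f v)) \<and> case_prod f \<in> smooth_vectors (Cu A P) (Cu_seminorms P) translation"
    if g: "g \<in> schwartz_into B Q" for g :: "real^'d \<Rightarrow> _"
  proof -
    obtain F where F: "case_prod g = Cu.T F" "F \<in> smooth_vectors (Cu A P) (Cu_seminorms P) translation"
      using g unfolding schwartz_into_def smooth by blast
    have "g = (\<lambda>v. T (curry F v))"
      unfolding curry_pullback[symmetric] F(1)[symmetric] by simp
    then show ?thesis using F(2) by (intro exI[of _ "curry F"]) simp
  qed
  moreover have "case_prod f \<in> smooth_vectors (Cu A P) (Cu_seminorms P) translation"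
    if "f \<in> schwartz_into A P" for f :: "real^'d \<Rightarrow> _"
    using that by (simp add: schwartz_into_def)
  ultimately show ?thesis using iff by blast
qed

lemma schwartz_norm_pullback:
  "schwartz_norm B Q q (\<lambda>v. T (f v)) = schwartz_norm A P (\<lambda>a. q (T a)) f"
proof -
  have "(\<lambda>v x. cnj (T (f v) x) * T (f v) x) = (\<lambda>v. T (\<lambda>x. cnj (f v x) * f v x))"
    by (auto simp: pullback_def fun_eq_iff)
  then show ?thesis by (simp add: schwartz_norm_def integral_into_pullback)
qed

text \<open>The operator of left multiplication by \<open>a\<close> and its pulled back counterpart are intertwined by a
  bijection of the Schwartz functions that is isometric for \<open>q\<close> composed with the pull-back and
  \<open>q\<close>, so the two suprema range over the same set.\<close>

lemma deformed_seminorm_pullback: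
  assumes "\<And>v. \<beta> v (T a) = T (\<alpha> v a)"
  shows "deformed_seminorm B Q \<beta> \<Theta> q (T a) = deformed_seminorm A P \<alpha> \<Theta> (\<lambda>f. q (T f)) a"
proof -
  have "Cu_product B Q \<Theta> (\<lambda>v. \<beta> v (T a)) (\<lambda>v. T (g v)) = (\<lambda>y. T (Cu_product A P \<Theta> (\<lambda>v. \<alpha> v a) g y))" for g
    using Cu_product_pullback[of \<Theta> "\<lambda>v. \<alpha> v a" g] by (simp add: assms fun_eq_iff)
  then have "{schwartz_norm B Q q (Cu_product B Q \<Theta> (\<lambda>v. \<beta> v (T a)) g) | g.
          g \<in> schwartz_into B Q \<and> schwartz_norm B Q q g \<le> 1}
    = {schwartz_norm A P (\<lambda>f. q (T f)) (Cu_product A P \<Theta> (\<lambda>v. \<alpha> v a) g) | g.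
          g \<in> schwartz_into A P \<and> schwartz_norm A P (\<lambda>f. q (T f)) g \<le> 1}"
    unfolding schwartz_into_pullback
    by (auto simp: schwartz_norm_pullback) (metis image_eqI schwartz_norm_pullback)+
  then show ?thesis by (simp add: deformed_seminorm_def)
qed

lemma pullback_push_function: "T (push_function K \<phi> f) = (\<lambda>x. if x \<in> K then f x else 0)"
  using inj by (auto simp: pullback_def push_function_def fun_eq_iff)

lemma transport_deformation:
  assumes equivariant: "\<And>v a. \<beta> v (T a) = T (\<alpha> v a)"
    and supported: "\<And>v a. supported (\<alpha> v a)"
    and norms: "\<And>q. q \<in> QB \<Longrightarrow> (\<lambda>f. q (T f)) \<in> QA"
  shows "star_isomorphism (smooth_vectors A P \<alpha>) (deformed_product A P \<alpha> \<Theta>)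
      (smooth_vectors B Q \<beta>) (deformed_product B Q \<beta> \<Theta>) T"
    and "continuous_map (deformed_topology A P \<alpha> \<Theta> QA) (deformed_topology B Q \<beta> \<Theta> QB) T"
    and "\<forall>f\<in>smooth_vectors B Q \<beta>. inv_into (smooth_vectors A P \<alpha>) T f = push_function K \<phi> f"
proof -
  let ?A = "smooth_vectors A P \<alpha>" and ?B = "smooth_vectors B Q \<beta>"
  have image_smooth: "?B = T ` ?A"
    by (rule smooth_vectors_pullback) (rule equivariant supported)+
  have sub: "?A \<subseteq> A" by (auto simp: smooth_vectors_def)
  have inj_smooth: "inj_on T ?A"
    using inj_on_pullback sub by (rule inj_on_subset)
  show "star_isomorphism ?A (deformed_product A P \<alpha> \<Theta>) ?B (deformed_product B Q \<beta> \<Theta>) T"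
    unfolding star_isomorphism_def
  proof (intro conjI ballI allI)
    show "bij_betw T ?A ?B" using inj_smooth image_smooth by (simp add: bij_betw_def)
    show "T (deformed_product A P \<alpha> \<Theta> a b) = deformed_product B Q \<beta> \<Theta> (T a) (T b)" for a b
      by (rule deformed_product_pullback[symmetric]) (rule equivariant)+
  qed (auto simp: pullback_def fun_eq_iff)
  show "\<forall>f\<in>?B. inv_into ?A T f = push_function K \<phi> f"
  proof
    fix f assume "f \<in> ?B"
    then obtain a where a: "a \<in> ?A" "f = T a" using image_smooth by blast
    have "push_function K \<phi> f = a"
    proof (rule pullback_inject)
      show "supported (push_function K \<phi> f)" by (simp add: push_function_def)
      show "supported a" using a sub vanishing by blast
      show "T (push_function K \<phi> f) = T a"
        unfolding pullback_push_function a(2) by (auto simp: pullback_def fun_eq_iff)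
    qed
    then show "inv_into ?A T f = push_function K \<phi> f"
      using a inj_smooth by simp
  qed
  show "continuous_map (deformed_topology A P \<alpha> \<Theta> QA) (deformed_topology B Q \<beta> \<Theta> QB) T"
    unfolding deformed_topology_def image_smooth
  proof (rule continuous_map_pullback_seminorms)
    fix s assume "s \<in> deformed_seminorm B Q \<beta> \<Theta> ` QB"
    then obtain q where q: "q \<in> QB" "s = deformed_seminorm B Q \<beta> \<Theta> q" by blast
    have "s (\<lambda>x. T b x - T a x) = deformed_seminorm A P \<alpha> \<Theta> (\<lambda>f. q (T f)) (\<lambda>x. b x - a x)" for a b
    proof -
      have "(\<lambda>x. T b x - T a x) = T (\<lambda>x. b x - a x)" by (auto simp: pullback_def fun_eq_iff)
      then show ?thesis
        unfolding q(2) using deformed_seminorm_pullback[of \<beta> _ \<alpha>] equivariant by metis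
    qed
    then show "\<exists>s'\<in>deformed_seminorm A P \<alpha> \<Theta> ` QA. \<forall>a b. s (\<lambda>x. T b x - T a x) = s' (\<lambda>x. b x - a x)"
      using norms[OF q(1)] by blast
  qed
qed

text \<open>A \<open>C\<^sup>*\<close>-seminorm is continuous if it is bounded by a multiple of a finite sum of defining
  seminorms. If these depend only on the values on \<open>K\<close>, they stay distinct when composed with the
  pull-back, so the sum over their images has the same terms and the bound carries over.\<close>

lemma cstar_seminorm_pullback:
  assumes on_K: "\<And>q f. q \<in> Q \<Longrightarrow> q (\<lambda>x. if x \<in> K then f x else 0) = q f"
    and q: "q \<in> cstar_seminorms B Q"
  shows "(\<lambda>f. q (T f)) \<in> cstar_seminorms A P"
proof -
  define pull where "pull = (\<lambda>(q :: ('k \<Rightarrow> complex) \<Rightarrow> real) f. q (T f))"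
  have ops: "T (\<lambda>x. z * a x) = (\<lambda>x. z * T a x)" "T (\<lambda>x. a x + b x) = (\<lambda>x. T a x + T b x)"
    "T (\<lambda>x. a x * b x) = (\<lambda>x. T a x * T b x)" "T (\<lambda>x. cnj (a x)) = (\<lambda>x. cnj (T a x))"
    for z a b
    by (auto simp: pullback_def fun_eq_iff)
  have mem: "T a \<in> B" if "a \<in> A" for a using that image by blast
  have inj_pull: "inj_on pull Q"
  proof (rule inj_onI, rule ext)
    fix p p' f assume p: "p \<in> Q" "p' \<in> Q" "pull p = pull p'"
    then have "p (T (push_function K \<phi> f)) = p' (T (push_function K \<phi> f))"
      by (simp add: pull_def fun_eq_iff)
    then show "p f = p' f" using p by (simp add: pullback_push_function on_K)
  qed
  obtain R C where R: "finite R" "R \<subseteq> Q" "\<forall>a\<in>B. q a \<le> C * (\<Sum>p\<in>R. p a)"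
    using q unfolding cstar_seminorms_def by blast
  have "(\<Sum>p\<in>pull ` R. p a) = (\<Sum>p\<in>R. p (T a))" for a
    using R(2) inj_pull by (subst sum.reindex) (auto simp: pull_def intro: inj_on_subset)
  then have "finite (pull ` R) \<and> pull ` R \<subseteq> P \<and> (\<forall>a\<in>A. q (T a) \<le> C * (\<Sum>p\<in>pull ` R. p a))"
    using R mem by (auto simp: seminorms pull_def)
  then have "\<exists>R' C'. finite R' \<and> R' \<subseteq> P \<and> (\<forall>a\<in>A. q (T a) \<le> C' * (\<Sum>p\<in>R'. p a))" by blast
  then show ?thesis
    using q mem unfolding cstar_seminorms_def by (simp add: ops)
qed

end

section \<open>Function algebras on homeomorphic subspaces\<close>

lemma pullback_C0:
  assumes "continuous_map (subtopology X U) (subtopology Y V) \<phi>" and "f \<in> C0 Y V"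
  shows "pullback U \<phi> f \<in> C0 X U"
proof -
  have "continuous_map (subtopology X U) euclidean (f \<circ> \<phi>)"
    using assms by (auto simp: C0_def intro: continuous_map_compose)
  then have "continuous_map (subtopology X U) euclidean (pullback U \<phi> f)"
    by (rule continuous_map_eq) (simp add: pullback_def topspace_subtopology)
  then show ?thesis by (simp add: C0_def pullback_def)
qed

lemma pullback_C0_bdd:
  assumes "continuous_map (subtopology X U) (subtopology Y V) \<phi>" "\<phi> ` U \<subseteq> V" and "f \<in> C0_bdd Y V"
  shows "pullback U \<phi> f \<in> C0_bdd X U"
proof -
  have "pullback U \<phi> f ` U \<subseteq> f ` V" using assms(2) by (auto simp: pullback_def)
  moreover have "bounded (f ` V)" and "f \<in> C0 Y V" using assms(3) by (simp_all add: C0_bdd_def)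
  ultimately show ?thesis
    using bounded_subset pullback_C0[OF assms(1)] by (simp add: C0_bdd_def)
qed

lemma compactin_image_subspace:
  assumes "continuous_map (subtopology Y V) (subtopology X U) \<psi>" "compactin Y L" "L \<subseteq> V"
  shows "compactin X (\<psi> ` L) \<and> \<psi> ` L \<subseteq> U"
proof -
  have "compactin (subtopology X U) (\<psi> ` L)"
    using assms by (intro image_compactin) (simp_all add: compactin_subtopology)
  then show ?thesis by (simp add: compactin_subtopology)
qed

text \<open>A function that is small off the compact set \<open>L\<close> pulls back to one that is small off the preimage
  of \<open>L\<close>, which is the image of \<open>L\<close> under the continuous inverse.\<close>

lemma pullback_C0_van:
  assumes "continuous_map (subtopology X U) (subtopology Y V) \<phi>"
    and "continuous_map (subtopology Y V) (subtopology X U) (inv_into U \<phi>)"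
    and "bij_betw \<phi> U V" and f: "f \<in> C0_van Y V"
  shows "pullback U \<phi> f \<in> C0_van X U"
  unfolding C0_van_def
proof (intro CollectI conjI allI impI)
  show "pullback U \<phi> f \<in> C0 X U"
    using assms pullback_C0 by (auto simp: C0_van_def)
  fix e :: real assume "e > 0"
  then obtain L where L: "compactin Y L" "L \<subseteq> V" "\<forall>y\<in>V - L. norm (f y) < e"
    using f unfolding C0_van_def by blast
  have "norm (pullback U \<phi> f x) < e" if "x \<in> U - inv_into U \<phi> ` L" for x
  proof -
    have "\<phi> x \<in> V" "inv_into U \<phi> (\<phi> x) = x"
      using that assms(3) by (auto simp: bij_betw_def)
    then have "\<phi> x \<in> V - L" using that by force
    then show ?thesis using that L(3) by (simp add: pullback_def)
  qed
  then show "\<exists>L. compactin X L \<and> L \<subseteq> U \<and> (\<forall>x\<in>U - L. norm (pullback U \<phi> f x) < e)"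
    using compactin_image_subspace[OF assms(2) L(1,2)] by blast
qed

lemma sup_seminorm_pullback:
  assumes "L \<subseteq> U"
  shows "sup_seminorm L (pullback U \<phi> f) = sup_seminorm (\<phi> ` L) f"
proof -
  have "(\<lambda>x. norm (pullback U \<phi> f x)) ` L = (\<lambda>y. norm (f y)) ` \<phi> ` L"
    using assms by (force simp: pullback_def image_image)
  then show ?thesis by (simp add: sup_seminorm_def)
qed

locale homeomorphic_subspaces =
  fixes X :: "'k topology" and U :: "'k set" and Y :: "'n topology" and V :: "'n set"
    and \<phi> :: "'k \<Rightarrow> 'n"
  assumes bij: "bij_betw \<phi> U V"
    and cont: "continuous_map (subtopology X U) (subtopology Y V) \<phi>"
    and cont_inv: "continuous_map (subtopology Y V) (subtopology X U) (inv_into U \<phi>)"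
begin

lemma image_V: "\<phi> ` U = V"
  using bij by (simp add: bij_betw_def)

lemma bij_inv: "bij_betw (inv_into U \<phi>) V U"
  using bij by (rule bij_betw_inv_into)

lemma inv_inv_cont: "continuous_map (subtopology X U) (subtopology Y V) (inv_into V (inv_into U \<phi>))"
  using cont
  by (rule continuous_map_eq) (use inv_into_inv_into_eq[OF bij] in \<open>simp add: topspace_subtopology\<close>)

text \<open>Pulling back by the inverse is a right inverse of pulling back on functions vanishing off \<open>U\<close>, so
  that surjectivity onto \<open>B\<close> follows from the inclusion for the inverse map.\<close>

lemma image_pullback_eq:
  assumes "\<And>f. f \<in> A \<Longrightarrow> pullback U \<phi> f \<in> B" and "\<And>g. g \<in> B \<Longrightarrow> pullback V (inv_into U \<phi>) g \<in> A"
    and "\<And>g x. g \<in> B \<Longrightarrow> x \<notin> U \<Longrightarrow> g x = 0"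
  shows "B = pullback U \<phi> ` A"
proof
  show "B \<subseteq> pullback U \<phi> ` A"
  proof
    fix g assume g: "g \<in> B"
    have "g = pullback U \<phi> (pullback V (inv_into U \<phi>) g)"
      using bij assms(3)[OF g] by (auto simp: pullback_def fun_eq_iff bij_betw_def)
    then show "g \<in> pullback U \<phi> ` A" using assms(2)[OF g] by blast
  qed
qed (use assms in blast)

text \<open>A homeomorphism puts the compact subsets of both sides in bijection.\<close>

lemma compact_seminorms_pullback:
  "compact_seminorms Y V = (\<lambda>q f. q (pullback U \<phi> f)) ` compact_seminorms X U"
proof -
  have eq: "{L. compactin Y L \<and> L \<subseteq> V} = (`) \<phi> ` {L. compactin X L \<and> L \<subseteq> U}"
  proof (intro equalityI subsetI)
    fix L assume L: "L \<in> {L. compactin Y L \<and> L \<subseteq> V}"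
    then have "L = \<phi> ` inv_into U \<phi> ` L"
      using image_V by (simp add: image_inv_into_cancel)
    moreover have "inv_into U \<phi> ` L \<in> {L. compactin X L \<and> L \<subseteq> U}"
      using L compactin_image_subspace[OF cont_inv, of L] by simp
    ultimately show "L \<in> (`) \<phi> ` {L. compactin X L \<and> L \<subseteq> U}"
      by (rule image_eqI)
  next
    fix L assume "L \<in> (`) \<phi> ` {L. compactin X L \<and> L \<subseteq> U}"
    then obtain L' where "L = \<phi> ` L'" "compactin X L'" "L' \<subseteq> U" by auto
    then show "L \<in> {L. compactin Y L \<and> L \<subseteq> V}"
      using compactin_image_subspace[OF cont, of L'] by simp
  qed
  have "sup_seminorm (\<phi> ` L) = (\<lambda>f. sup_seminorm L (pullback U \<phi> f))" if "L \<subseteq> U" for L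
    using that by (simp add: sup_seminorm_pullback)
  then show ?thesis
    unfolding compact_seminorms_def eq image_image by (intro image_cong) auto
qed

lemma transport_C0:
  "function_transport U \<phi> (C0 Y V) (compact_seminorms Y V) (C0 X U) (compact_seminorms X U)"
proof
  show "C0 X U = pullback U \<phi> ` C0 Y V"
    using pullback_C0[OF cont] pullback_C0[OF cont_inv] by (rule image_pullback_eq) (auto simp: C0_def)
qed (use compact_seminorms_pullback in \<open>simp_all add: bij[THEN bij_betw_imp_inj_on] C0_def image_V\<close>)

lemma sup_seminorm_transport: "{sup_seminorm V} = (\<lambda>q f. q (pullback U \<phi> f)) ` {sup_seminorm U}"
  by (simp add: sup_seminorm_pullback image_V fun_eq_iff)

lemma transport_C0_bdd:
  "function_transport U \<phi> (C0_bdd Y V) {sup_seminorm V} (C0_bdd X U) {sup_seminorm U}"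
proof
  show "C0_bdd X U = pullback U \<phi> ` C0_bdd Y V"
    using pullback_C0_bdd[OF cont] pullback_C0_bdd[OF cont_inv] bij_inv image_V
    by (intro image_pullback_eq) (auto simp: C0_bdd_def C0_def bij_betw_def)
qed (use sup_seminorm_transport in \<open>simp_all add: bij[THEN bij_betw_imp_inj_on] C0_bdd_def C0_def image_V\<close>)

lemma transport_C0_van:
  "function_transport U \<phi> (C0_van Y V) {sup_seminorm V} (C0_van X U) {sup_seminorm U}"
proof
  show "C0_van X U = pullback U \<phi> ` C0_van Y V"
    using pullback_C0_van[OF cont cont_inv bij] pullback_C0_van[OF cont_inv inv_inv_cont bij_inv]
    by (rule image_pullback_eq) (auto simp: C0_van_def C0_def)
qed (use sup_seminorm_transport in \<open>simp_all add: bij[THEN bij_betw_imp_inj_on] C0_van_def C0_def image_V\<close>)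

lemma compact_seminorms_local:
  "q \<in> compact_seminorms X U \<Longrightarrow> q (\<lambda>x. if x \<in> U then f x else 0) = q f"
proof -
  assume "q \<in> compact_seminorms X U"
  then obtain L where L: "q = sup_seminorm L" "L \<subseteq> U" by (auto simp: compact_seminorms_def)
  then have "(\<lambda>x. norm (if x \<in> U then f x else 0)) ` L = (\<lambda>x. norm (f x)) ` L"
    by (intro image_cong) auto
  then show ?thesis by (simp add: L sup_seminorm_def)
qed

end

section \<open>Charts and velocities of curves\<close>

lemma openin_chart_domain:
  assumes "c \<in> A"
  shows "openin (mtop A) (fst c)"
proof -
  have "fst c = fst c \<inter> snd c -` UNIV" by simp
  then have "fst c \<in> {fst c \<inter> snd c -` W |c W. c \<in> A \<and> open W}"
    using assms open_UNIV by blast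
  then show ?thesis unfolding mtop_def by (rule topology_generated_by_Basis)
qed

lemma topspace_mtop: "topspace (mtop A) = points A"
proof
  show "topspace (mtop A) \<subseteq> points A"
    unfolding mtop_def topology_generated_by_topspace points_def by auto
  show "points A \<subseteq> topspace (mtop A)"
    using openin_subset[OF openin_chart_domain] unfolding points_def by blast
qed

lemma chart_inv_chart: "inj_on (snd c) (fst c) \<Longrightarrow> x \<in> fst c \<Longrightarrow> chart_inv c (snd c x) = x"
  by (simp add: chart_inv_def)

definition injective_charts :: "('a, 'e) atlas \<Rightarrow> bool" where
  "injective_charts A \<longleftrightarrow> (\<forall>c\<in>A. inj_on (snd c) (fst c))"

text \<open>The coordinates of a tangent vector in one chart determine those in every other chart through the
  transition map; in charts that do not contain the point they are 0.\<close>

lemma tangent_vector_eqI: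
  assumes "c \<in> M" "p \<in> fst c" "\<xi> \<in> tangent_space M p" "\<eta> \<in> tangent_space M p" "\<xi> c = \<eta> c"
  shows "\<xi> = \<eta>"
proof
  fix c' show "\<xi> c' = \<eta> c'"
  proof (cases "c' \<in> M \<and> p \<in> fst c'")
    case True
    have transition: "\<zeta> c' = frechet_derivative (snd c' \<circ> chart_inv c) (at (snd c p)) (\<zeta> c)"
      if "\<zeta> \<in> tangent_space M p" for \<zeta>
      using that True assms(1,2) unfolding tangent_space_def by blast
    show ?thesis unfolding transition[OF assms(3)] transition[OF assms(4)] assms(5) ..
  next
    case False
    have "\<zeta> c' = 0" if "\<zeta> \<in> tangent_space M p" for \<zeta>
      using that False unfolding tangent_space_def by blast
    then show ?thesis using assms(3,4) by metis
  qed
qed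

lemma injective_charts_tangent_atlas:
  assumes "injective_charts M"
  shows "injective_charts (tangent_atlas M)"
proof -
  have "inj_on (\<lambda>(p, \<xi>). (snd c p, \<xi> c)) {(p, \<xi>). p \<in> fst c \<and> \<xi> \<in> tangent_space M p}"
    if c: "c \<in> M" for c
  proof (rule inj_onI)
    fix x y
    assume x: "x \<in> {(p, \<xi>). p \<in> fst c \<and> \<xi> \<in> tangent_space M p}"
      and y: "y \<in> {(p, \<xi>). p \<in> fst c \<and> \<xi> \<in> tangent_space M p}"
      and eq: "(\<lambda>(p, \<xi>). (snd c p, \<xi> c)) x = (\<lambda>(p, \<xi>). (snd c p, \<xi> c)) y"
    obtain p \<xi> q \<eta> where xy: "x = (p, \<xi>)" "y = (q, \<eta>)" by (cases x, cases y)
    have "inj_on (snd c) (fst c)" using assms c by (simp add: injective_charts_def)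
    then have "p = q" using x y eq by (simp add: xy inj_on_eq_iff)
    moreover have "\<xi> = \<eta>"
      using x y eq \<open>p = q\<close> by (intro tangent_vector_eqI[OF c, of p]) (simp_all add: xy)
    ultimately show "x = y" by (simp add: xy)
  qed
  then show ?thesis
    unfolding injective_charts_def tangent_atlas_def by simp
qed

lemma injective_charts_prod_atlas:
  "injective_charts A \<Longrightarrow> injective_charts B \<Longrightarrow> injective_charts (prod_atlas A B)"
  by (auto simp: injective_charts_def prod_atlas_def intro!: map_prod_inj_on)

lemma eventually_curve_in_open:
  assumes "continuous_map euclideanreal X \<gamma>" "openin X W" "\<gamma> t \<in> W"
  shows "\<forall>\<^sub>F s in nhds t. \<gamma> s \<in> W"
proof -
  have "open {s. \<gamma> s \<in> W}"
    using assms(1,2) by (auto simp: continuous_map_def)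
  then show ?thesis using assms(3) by (auto simp: eventually_nhds)
qed

lemma has_vector_derivative_transfer_nhds:
  assumes "(f has_vector_derivative d) (at t)" and "\<forall>\<^sub>F s in nhds t. f s = g s"
  shows "(g has_vector_derivative d) (at t)"
  using assms has_vector_derivative_transform_within_open unfolding eventually_nhds by blast

text \<open>Near \<open>t\<close> the curve \<open>F \<circ> \<gamma>\<close> in the chart \<open>c'\<close> is the coordinate expression of \<open>F\<close> applied to \<open>\<gamma>\<close>
  in the chart \<open>c\<close>. It is enough that the curve lies in \<open>S\<close> at the time \<open>t\<close>, because the coordinate
  expression is differentiable at that point as a map on a full neighbourhood.\<close>

lemma smooth_map_chain_rule:
  assumes F: "smooth_map A S B F" and charts: "injective_charts A" "c \<in> A" "c' \<in> B"
    and point: "\<gamma> t \<in> S" "\<gamma> t \<in> fst c" "F (\<gamma> t) \<in> fst c'"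
    and near: "\<forall>\<^sub>F s in nhds t. \<gamma> s \<in> fst c"
    and deriv: "((snd c \<circ> \<gamma>) has_vector_derivative \<xi>) (at t)"
  shows "((snd c' \<circ> (F \<circ> \<gamma>)) has_vector_derivative
    frechet_derivative (snd c' \<circ> F \<circ> chart_inv c) (at (snd c (\<gamma> t))) \<xi>) (at t)"
proof -
  let ?G = "snd c' \<circ> F \<circ> chart_inv c"
  have inj: "inj_on (snd c) (fst c)" using charts by (simp add: injective_charts_def)
  have "smooth_on (snd c ` {x \<in> S \<inter> fst c. F x \<in> fst c'}) ?G"
    using F charts by (simp add: smooth_map_def)
  then have "higher_differentiable_on (snd c ` {x \<in> S \<inter> fst c. F x \<in> fst c'}) ?G (Suc 0)"
    unfolding smooth_on_def by blast
  then have "\<forall>y\<in>snd c ` {x \<in> S \<inter> fst c. F x \<in> fst c'}. ?G differentiable (at y)"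
    by simp
  moreover have "snd c (\<gamma> t) \<in> snd c ` {x \<in> S \<inter> fst c. F x \<in> fst c'}"
    using point by blast
  ultimately have "?G differentiable (at (snd c (\<gamma> t)))"
    by blast
  then have "(?G has_derivative frechet_derivative ?G (at (snd c (\<gamma> t)))) (at ((snd c \<circ> \<gamma>) t))"
    unfolding frechet_derivative_works comp_apply[of "snd c" \<gamma>] .
  then have "(?G has_derivative frechet_derivative ?G (at (snd c (\<gamma> t))))
      (at ((snd c \<circ> \<gamma>) t) within range (snd c \<circ> \<gamma>))"
    by (rule has_derivative_at_withinI)
  from vector_derivative_diff_chain_within[OF deriv this]
  have "((?G \<circ> (snd c \<circ> \<gamma>)) has_vector_derivative
      frechet_derivative ?G (at (snd c (\<gamma> t))) \<xi>) (at t)" .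
  moreover have "\<forall>\<^sub>F s in nhds t. (?G \<circ> (snd c \<circ> \<gamma>)) s = (snd c' \<circ> (F \<circ> \<gamma>)) s"
    using near by (rule eventually_mono) (simp add: chart_inv_chart[OF inj])
  ultimately show ?thesis
    by (rule has_vector_derivative_transfer_nhds)
qed

lemma chart_at_mem:
  assumes "x \<in> points A"
  shows "chart_at A x \<in> A" "x \<in> fst (chart_at A x)"
proof -
  have "\<exists>c. c \<in> A \<and> x \<in> fst c" using assms by (auto simp: points_def)
  then have "chart_at A x \<in> A \<and> x \<in> fst (chart_at A x)" unfolding chart_at_def by (rule someI_ex)
  then show "chart_at A x \<in> A" "x \<in> fst (chart_at A x)" by auto
qed

section \<open>Flows of a vector field and of its push-forward\<close>

text \<open>The condition \<open>velocity\<close> says that every value of \<open>Z\<close> on \<open>U\<close> is the velocity of some curve. For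
  a fundamental vector field of an action these curves are the orbits of one-parameter subgroups.\<close>

locale pushed_forward_field =
  fixes A :: "('a, 'e::euclidean_space) atlas" and U :: "'a set"
    and B :: "('b, 'f::euclidean_space) atlas" and V :: "'b set"
    and \<Phi> :: "'a \<Rightarrow> 'b" and Z :: "'a \<Rightarrow> ('a, 'e) tangent"
  assumes charts: "injective_charts A" "injective_charts B"
    and open_sets: "openin (mtop A) U" "openin (mtop B) V"
    and diffeo: "diffeomorphism A U B V \<Phi>"
    and velocity: "x \<in> U \<Longrightarrow> \<exists>\<eta>. continuous_map euclideanreal (mtop A) \<eta> \<and> \<eta> 0 = x \<and>
      (\<forall>c\<in>A. x \<in> fst c \<longrightarrow> ((snd c \<circ> \<eta>) has_vector_derivative Z x c) (at 0))"
    and support: "vector_field_support A Z \<subseteq> U"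
begin

abbreviation Z' where "Z' \<equiv> pushforward A U B \<Phi> Z"
abbreviation \<Psi> where "\<Psi> \<equiv> inv_into U \<Phi>"

lemma bij: "bij_betw \<Phi> U V" and smooth: "smooth_map A U B \<Phi>" "smooth_map B V A \<Psi>"
  using diffeo by (simp_all add: diffeomorphism_def)

lemma inverse: "x \<in> U \<Longrightarrow> \<Psi> (\<Phi> x) = x" "y \<in> V \<Longrightarrow> \<Phi> (\<Psi> y) = y" "x \<in> U \<Longrightarrow> \<Phi> x \<in> V" "y \<in> V \<Longrightarrow> \<Psi> y \<in> U"
  using bij_betw_inv_into_left[OF bij] bij_betw_inv_into_right[OF bij]
    bij_betwE[OF bij] bij_betwE[OF bij_betw_inv_into[OF bij]] by blast+

lemma subset_points: "U \<subseteq> points A" "V \<subseteq> points B"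
  using openin_subset[OF open_sets(1)] openin_subset[OF open_sets(2)] by (simp_all add: topspace_mtop)

lemma continuous: "continuous_map (subtopology (mtop A) U) (mtop B) \<Phi>"
  "continuous_map (subtopology (mtop B) V) (mtop A) \<Psi>"
  using smooth unfolding smooth_map_def by blast+

lemma push_velocity:
  assumes \<gamma>: "continuous_map euclideanreal (mtop A) \<gamma>" "\<gamma> t \<in> U"
    and deriv: "\<And>c. c \<in> A \<Longrightarrow> \<gamma> t \<in> fst c \<Longrightarrow> ((snd c \<circ> \<gamma>) has_vector_derivative Z (\<gamma> t) c) (at t)"
    and c': "c' \<in> B" "\<Phi> (\<gamma> t) \<in> fst c'"
  shows "((snd c' \<circ> (\<Phi> \<circ> \<gamma>)) has_vector_derivative Z' (\<Phi> (\<gamma> t)) c') (at t)"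
proof -
  define c where "c = chart_at A (\<gamma> t)"
  have c: "c \<in> A" "\<gamma> t \<in> fst c"
    unfolding c_def using chart_at_mem[OF subsetD[OF subset_points(1) \<gamma>(2)]] by simp_all
  have "\<forall>\<^sub>F s in nhds t. \<gamma> s \<in> fst c"
    using \<gamma>(1) openin_chart_domain[OF c(1)] c(2) by (rule eventually_curve_in_open)
  note smooth_map_chain_rule[OF smooth(1) charts(1) c(1) c'(1) \<gamma>(2) c(2) c'(2) this deriv[OF c]]
  moreover have "Z' (\<Phi> (\<gamma> t)) c'
      = frechet_derivative (snd c' \<circ> \<Phi> \<circ> chart_inv c) (at (snd c (\<gamma> t))) (Z (\<gamma> t) c)"
    using \<gamma>(2) c' by (simp add: pushforward_def tangent_map_def inverse c_def Let_def)
  ultimately show ?thesis by simp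
qed

text \<open>The velocity of \<open>\<Psi> \<circ> \<delta>\<close> in the chart \<open>c\<close> is the differential of \<open>\<Psi>\<close> applied to that of \<open>\<delta>\<close>. To
  see that the differential of \<open>\<Psi>\<close> maps the push-forward back to \<open>Z\<close>, take a curve \<open>\<eta>\<close> through the
  point with velocity \<open>Z\<close>: its image under \<open>\<Phi>\<close> has the push-forward as its velocity, and near time 0
  applying \<open>\<Psi>\<close> to this image gives \<open>\<eta>\<close> again.\<close>

lemma pull_velocity:
  assumes \<delta>: "continuous_map euclideanreal (mtop B) \<delta>" "\<delta> t \<in> V"
    and deriv: "\<And>c'. c' \<in> B \<Longrightarrow> \<delta> t \<in> fst c' \<Longrightarrow> ((snd c' \<circ> \<delta>) has_vector_derivative Z' (\<delta> t) c') (at t)"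
    and c: "c \<in> A" "\<Psi> (\<delta> t) \<in> fst c"
  shows "((snd c \<circ> (\<Psi> \<circ> \<delta>)) has_vector_derivative Z (\<Psi> (\<delta> t)) c) (at t)"
proof -
  define x where "x = \<Psi> (\<delta> t)"
  have x: "x \<in> U" "\<Phi> x = \<delta> t" "x \<in> fst c" using \<delta>(2) c by (simp_all add: x_def inverse)
  obtain \<eta> where \<eta>: "continuous_map euclideanreal (mtop A) \<eta>" "\<eta> 0 = x"
    "\<And>c. c \<in> A \<Longrightarrow> x \<in> fst c \<Longrightarrow> ((snd c \<circ> \<eta>) has_vector_derivative Z x c) (at 0)"
    using velocity[OF x(1)] by blast
  obtain c' where c': "c' \<in> B" "\<delta> t \<in> fst c'"
    using chart_at_mem[OF subsetD[OF subset_points(2) \<delta>(2)]] by simp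
  let ?D = "frechet_derivative (snd c \<circ> \<Psi> \<circ> chart_inv c') (at (snd c' (\<delta> t)))"
  have "\<forall>\<^sub>F s in nhds t. \<delta> s \<in> fst c'"
    using \<delta>(1) openin_chart_domain[OF c'(1)] c'(2) by (rule eventually_curve_in_open)
  from smooth_map_chain_rule[OF smooth(2) charts(2) c'(1) c(1) \<delta>(2) c'(2) c(2) this deriv[OF c']]
  have pulled: "((snd c \<circ> (\<Psi> \<circ> \<delta>)) has_vector_derivative ?D (Z' (\<delta> t) c')) (at t)" .
  have "openin (subtopology (mtop A) U) {y \<in> topspace (subtopology (mtop A) U). \<Phi> y \<in> fst c'}"
    using continuous(1) openin_chart_domain[OF c'(1)] by (rule openin_continuous_map_preimage)
  then have "openin (mtop A) {y \<in> topspace (subtopology (mtop A) U). \<Phi> y \<in> fst c'}"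
    using open_sets(1) openin_trans_full by blast
  moreover have "{y \<in> topspace (subtopology (mtop A) U). \<Phi> y \<in> fst c'} = {y \<in> U. \<Phi> y \<in> fst c'}"
    using subset_points(1) by (auto simp: topspace_subtopology topspace_mtop)
  ultimately have near: "\<forall>\<^sub>F s in nhds 0. \<eta> s \<in> {y \<in> U. \<Phi> y \<in> fst c'}"
    using x c' \<eta>(2) by (intro eventually_curve_in_open[OF \<eta>(1)]) auto
  have "((snd c' \<circ> (\<Phi> \<circ> \<eta>)) has_vector_derivative Z' (\<Phi> (\<eta> 0)) c') (at 0)"
    using \<eta> x c' by (intro push_velocity) auto
  then have pushed: "((snd c' \<circ> (\<Phi> \<circ> \<eta>)) has_vector_derivative Z' (\<delta> t) c') (at 0)"
    using \<eta>(2) x(2) by simp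
  have "((snd c \<circ> (\<Psi> \<circ> (\<Phi> \<circ> \<eta>))) has_vector_derivative
      frechet_derivative (snd c \<circ> \<Psi> \<circ> chart_inv c') (at (snd c' ((\<Phi> \<circ> \<eta>) 0))) (Z' (\<delta> t) c')) (at 0)"
  proof (rule smooth_map_chain_rule[OF smooth(2) charts(2) c'(1) c(1) _ _ _ _ pushed])
    show "\<forall>\<^sub>F s in nhds 0. (\<Phi> \<circ> \<eta>) s \<in> fst c'"
      using near by (rule eventually_mono) simp
  qed (use \<eta>(2) x c c' \<delta>(2) in \<open>simp_all add: x_def\<close>)
  then have "((snd c \<circ> (\<Psi> \<circ> (\<Phi> \<circ> \<eta>))) has_vector_derivative ?D (Z' (\<delta> t) c')) (at 0)"
    using \<eta>(2) x(2) by simp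
  moreover have "\<forall>\<^sub>F s in nhds 0. (snd c \<circ> (\<Psi> \<circ> (\<Phi> \<circ> \<eta>))) s = (snd c \<circ> \<eta>) s"
    using near by (rule eventually_mono) (simp add: inverse)
  ultimately have "((snd c \<circ> \<eta>) has_vector_derivative ?D (Z' (\<delta> t) c')) (at 0)"
    by (rule has_vector_derivative_transfer_nhds)
  then have "?D (Z' (\<delta> t) c') = Z x c"
    using \<eta>(3)[OF c(1) x(3)] by (rule vector_derivative_unique_at)
  then show ?thesis using pulled by (simp add: x_def)
qed

text \<open>The times at which the curve is in \<open>U\<close> form an open set because \<open>U\<close> is open. So do the
  others: off \<open>U\<close> the point lies in the open complement of the support, where the field vanishes,
  and so the curve is constant for a short time around. As the real line is connected, one of the
  two sets is empty.\<close>

lemma integral_curve_stays: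
  assumes \<gamma>: "integral_curve A (points A) Z \<gamma>" and start: "\<gamma> 0 \<in> U"
  shows "\<gamma> t \<in> U"
proof -
  have cont: "continuous_map euclideanreal (mtop A) \<gamma>" and in_points: "\<gamma> s \<in> points A" for s
    using \<gamma> by (auto simp: integral_curve_def continuous_map_in_subtopology)
  define N where "N = points A - vector_field_support A Z"
  have N_open: "openin (mtop A) N"
    unfolding N_def vector_field_support_def topspace_mtop[symmetric]
    by (rule openin_diff) auto
  have Z_zero: "Z x c = 0" if "x \<in> N" for x c
  proof -
    have "{x \<in> points A. Z x \<noteq> (\<lambda>c. 0)} \<subseteq> vector_field_support A Z"
      unfolding vector_field_support_def by (rule closure_of_subset) (auto simp: topspace_mtop)
    then have "Z x = (\<lambda>c. 0)" using that by (auto simp: N_def)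
    then show ?thesis by simp
  qed
  have "open {s. \<gamma> s \<in> U}"
    using cont open_sets(1) by (auto simp: continuous_map_def)
  moreover have "open {s. \<gamma> s \<notin> U}"
  proof (subst open_subopen, clarify)
    fix s assume s: "\<gamma> s \<notin> U"
    obtain c where c: "c \<in> A" "\<gamma> s \<in> fst c"
      using chart_at_mem[OF in_points[of s]] by simp
    have "\<gamma> s \<in> N \<inter> fst c"
      using s support in_points c by (auto simp: N_def)
    then have "\<forall>\<^sub>F r in nhds s. \<gamma> r \<in> N \<inter> fst c"
      by (intro eventually_curve_in_open[OF cont] openin_Int N_open openin_chart_domain c)
    then obtain e where e: "e > 0" "\<And>r. dist r s < e \<Longrightarrow> \<gamma> r \<in> N \<inter> fst c"
      unfolding eventually_nhds_metric by blast
    have "((snd c \<circ> \<gamma>) has_vector_derivative 0) (at r within ball s e)" if "r \<in> ball s e" for r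
    proof -
      have "\<gamma> r \<in> N \<inter> fst c" using that e(2) by (simp add: dist_commute)
      then show ?thesis
        using \<gamma> c(1) Z_zero unfolding integral_curve_def
        by (metis IntD1 IntD2 has_vector_derivative_at_within)
    qed
    \<comment> \<open>Injectivity of the chart turns constant coordinates into a constant curve.\<close>
    then obtain k where k: "\<And>r. r \<in> ball s e \<Longrightarrow> (snd c \<circ> \<gamma>) r = k"
      using has_vector_derivative_zero_constant[OF convex_ball] by blast
    have "\<gamma> r \<notin> U" if "r \<in> ball s e" for r
    proof -
      have "snd c (\<gamma> r) = snd c (\<gamma> s)"
        using k[OF that] k[of s] e(1) by simp
      moreover have "\<gamma> r \<in> fst c" using that e(2) by (simp add: dist_commute)
      ultimately have "\<gamma> r = \<gamma> s"
        using charts(1) c unfolding injective_charts_def by (blast dest: inj_onD)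
      then show ?thesis using s by simp
    qed
    then have "open (ball s e) \<and> s \<in> ball s e \<and> ball s e \<subseteq> {s. \<gamma> s \<notin> U}"
      using e(1) by auto
    then show "\<exists>W. open W \<and> s \<in> W \<and> W \<subseteq> {s. \<gamma> s \<notin> U}" ..
  qed
  ultimately have "{s. \<gamma> s \<notin> U} = {}"
    using connectedD[OF connected_UNIV, of "{s. \<gamma> s \<in> U}" "{s. \<gamma> s \<notin> U}"] start by blast
  then show ?thesis by blast
qed

lemma push_integral_curve:
  assumes \<gamma>: "integral_curve A (points A) Z \<gamma>" and start: "\<gamma> 0 \<in> U"
  shows "integral_curve B V Z' (\<Phi> \<circ> \<gamma>)"
proof -
  note stays = integral_curve_stays[OF assms]
  have cont: "continuous_map euclideanreal (mtop A) \<gamma>"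
    using \<gamma> by (auto simp: integral_curve_def continuous_map_in_subtopology)
  then have "continuous_map euclideanreal (subtopology (mtop A) U) \<gamma>"
    using stays by (auto simp: continuous_map_in_subtopology)
  then have "continuous_map euclideanreal (mtop B) (\<Phi> \<circ> \<gamma>)"
    using continuous(1) by (rule continuous_map_compose)
  then have "continuous_map euclideanreal (subtopology (mtop B) V) (\<Phi> \<circ> \<gamma>)"
    using stays inverse(3) by (auto simp: continuous_map_in_subtopology)
  then show ?thesis
    using push_velocity[OF cont stays] \<gamma> unfolding integral_curve_def comp_apply by blast
qed

lemma pull_integral_curve:
  assumes \<delta>: "integral_curve B V Z' \<delta>"
  shows "integral_curve A (points A) Z (\<Psi> \<circ> \<delta>)"
proof -
  have cont_V: "continuous_map euclideanreal (subtopology (mtop B) V) \<delta>"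
    using \<delta> by (simp add: integral_curve_def)
  then have cont: "continuous_map euclideanreal (mtop B) \<delta>" and in_V: "\<delta> t \<in> V" for t
    by (auto simp: continuous_map_in_subtopology)
  have "continuous_map euclideanreal (mtop A) (\<Psi> \<circ> \<delta>)"
    using cont_V continuous(2) by (rule continuous_map_compose)
  then have "continuous_map euclideanreal (subtopology (mtop A) (points A)) (\<Psi> \<circ> \<delta>)"
    using in_V inverse(4) subset_points(1) by (auto simp: continuous_map_in_subtopology)
  then show ?thesis
    using pull_velocity[OF cont in_V] \<delta> unfolding integral_curve_def comp_apply by blast
qed

text \<open>Composition with \<open>\<Phi>\<close> is a bijection between the integral curves from \<open>x\<close> and those from \<open>\<Phi> x\<close>. If
  there is exactly one of each, both flows follow it, and otherwise both are the identity.\<close>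

lemma flow_push:
  assumes x: "x \<in> U"
  shows "flow A (points A) Z t x \<in> U"
    and "flow B V Z' t (\<Phi> x) = \<Phi> (flow A (points A) Z t x)"
proof -
  let ?C = "\<lambda>\<gamma>. integral_curve A (points A) Z \<gamma> \<and> \<gamma> 0 = x"
  let ?D = "\<lambda>\<delta>. integral_curve B V Z' \<delta> \<and> \<delta> 0 = \<Phi> x"
  have push: "?D (\<Phi> \<circ> \<gamma>)" and left_inv: "\<Psi> \<circ> (\<Phi> \<circ> \<gamma>) = \<gamma>" and stays: "\<gamma> s \<in> U" if "?C \<gamma>" for \<gamma> s
    using that x push_integral_curve[of \<gamma>] integral_curve_stays[of \<gamma>] by (auto simp: fun_eq_iff inverse)
  have pull: "?C (\<Psi> \<circ> \<delta>)" and right_inv: "\<Phi> \<circ> (\<Psi> \<circ> \<delta>) = \<delta>" if "?D \<delta>" for \<delta>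
  proof -
    show "?C (\<Psi> \<circ> \<delta>)" using that x pull_integral_curve[of \<delta>] by (simp add: inverse)
    have "\<delta> s \<in> V" for s
      using that by (auto simp: integral_curve_def continuous_map_in_subtopology)
    then show "\<Phi> \<circ> (\<Psi> \<circ> \<delta>) = \<delta>" by (simp add: fun_eq_iff inverse)
  qed
  have unique_iff: "(\<exists>!\<gamma>. ?C \<gamma>) \<longleftrightarrow> (\<exists>!\<delta>. ?D \<delta>)"
  proof
    assume "\<exists>!\<gamma>. ?C \<gamma>"
    then obtain \<gamma> where \<gamma>: "?C \<gamma>" "\<And>\<gamma>'. ?C \<gamma>' \<Longrightarrow> \<gamma>' = \<gamma>" by blast
    show "\<exists>!\<delta>. ?D \<delta>"
    proof (rule ex1I)
      show "?D (\<Phi> \<circ> \<gamma>)" using \<gamma>(1) by (rule push)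
      fix \<delta> assume \<delta>: "?D \<delta>"
      show "\<delta> = \<Phi> \<circ> \<gamma>" using right_inv[OF \<delta>] unfolding \<gamma>(2)[OF pull[OF \<delta>]] by (rule sym)
    qed
  next
    assume "\<exists>!\<delta>. ?D \<delta>"
    then obtain \<delta> where \<delta>: "?D \<delta>" "\<And>\<delta>'. ?D \<delta>' \<Longrightarrow> \<delta>' = \<delta>" by blast
    show "\<exists>!\<gamma>. ?C \<gamma>"
    proof (rule ex1I)
      show "?C (\<Psi> \<circ> \<delta>)" using \<delta>(1) by (rule pull)
      fix \<gamma> assume \<gamma>: "?C \<gamma>"
      show "\<gamma> = \<Psi> \<circ> \<delta>" using left_inv[OF \<gamma>] unfolding \<delta>(2)[OF push[OF \<gamma>]] by (rule sym)
    qed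
  qed
  have "flow A (points A) Z t x \<in> U \<and> flow B V Z' t (\<Phi> x) = \<Phi> (flow A (points A) Z t x)"
  proof (cases "\<exists>!\<gamma>. ?C \<gamma>")
    case True
    then obtain \<gamma> where \<gamma>: "?C \<gamma>" by blast
    have "(THE \<gamma>. ?C \<gamma>) = \<gamma>" using True \<gamma> by (intro the1_equality[where P = ?C])
    moreover have "(THE \<delta>. ?D \<delta>) = \<Phi> \<circ> \<gamma>"
      using True push[OF \<gamma>] unfolding unique_iff by (intro the1_equality[where P = ?D])
    ultimately show ?thesis
      using True unique_iff stays[OF \<gamma>] by (simp add: flow_def)
  next
    case False
    then show ?thesis using unique_iff x unfolding flow_def by simp
  qed
  then show "flow A (points A) Z t x \<in> U"
    and "flow B V Z' t (\<Phi> x) = \<Phi> (flow A (points A) Z t x)" by auto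
qed

end

text \<open>Each flow maps \<open>U\<close> to itself, so the correspondence of single flows can be iterated.\<close>

lemma composed_flows_push:
  fixes Z :: "'d::{finite,linorder} \<Rightarrow> 'a \<Rightarrow> ('a, 'e::euclidean_space) tangent"
  assumes "\<And>i. pushed_forward_field A U B V \<Phi> (Z i)" and "x \<in> U"
  shows "composed_flows A (points A) Z v x \<in> U \<and>
    composed_flows B V (\<lambda>i. pushforward A U B \<Phi> (Z i)) v (\<Phi> x) = \<Phi> (composed_flows A (points A) Z v x)"
proof -
  have "foldr (\<lambda>i. (\<circ>) (flow A (points A) (Z i) (v $ i))) is id x \<in> U \<and>
    foldr (\<lambda>i. (\<circ>) (flow B V (pushforward A U B \<Phi> (Z i)) (v $ i))) is id (\<Phi> x)
      = \<Phi> (foldr (\<lambda>i. (\<circ>) (flow A (points A) (Z i) (v $ i))) is id x)" for "is"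
    using assms(2) by (induction "is") (simp_all add: pushed_forward_field.flow_push[OF assms(1)])
  then show ?thesis by (simp add: composed_flows_def)
qed

lemma induced_action_pullback:
  fixes Z :: "'d::{finite,linorder} \<Rightarrow> 'a \<Rightarrow> ('a, 'e::euclidean_space) tangent"
  assumes "\<And>i. pushed_forward_field A U B V \<Phi> (Z i)"
  shows "induced_action A (points A) U Z v (pullback U \<Phi> f)
    = pullback U \<Phi> (induced_action B V V (\<lambda>i. pushforward A U B \<Phi> (Z i)) v f)"
proof
  fix x
  have "\<Phi> x \<in> V" if "x \<in> U"
    using that pushed_forward_field.inverse(3)[OF assms] by blast
  then show "induced_action A (points A) U Z v (pullback U \<Phi> f) x
    = pullback U \<Phi> (induced_action B V V (\<lambda>i. pushforward A U B \<Phi> (Z i)) v f) x"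
    using composed_flows_push[where Z = Z and x = x and v = v, OF assms] by (auto simp: induced_action_def pullback_def)
qed

text \<open>The topology of the product atlas is generated by the products of charts, so that continuity of
  \<open>t \<mapsto> (t b, x)\<close> can be read off in coordinates, where the second component is constant.\<close>

lemma continuous_action_orbit:
  fixes \<psi> :: "'v::euclidean_space \<Rightarrow> 'a \<Rightarrow> 'a" and A :: "('a, 'e::euclidean_space) atlas"
  assumes act: "continuous_map (subtopology (mtop (prod_atlas {(UNIV, id)} A)) (UNIV \<times> points A)) (mtop A)
      (\<lambda>(v, x). \<psi> v x)"
    and x: "x \<in> points A"
  shows "continuous_map euclideanreal (mtop A) (\<lambda>t. \<psi> (t *\<^sub>R b) x)"
proof -
  let ?S = "prod_atlas {(UNIV :: 'v set, id :: 'v \<Rightarrow> 'v)} A"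
  have "continuous_map euclideanreal (mtop ?S) (\<lambda>t. (t *\<^sub>R b, x))"
    unfolding mtop_def
  proof (rule continuous_on_generated_topo)
    fix G assume "G \<in> {fst c \<inter> snd c -` W |c W. c \<in> ?S \<and> open W}"
    then obtain c' W where c': "c' \<in> A" "open W" "G = (UNIV \<times> fst c') \<inter> map_prod id (snd c') -` W"
      by (auto simp: prod_atlas_def)
    have "continuous_on UNIV (\<lambda>t. (t *\<^sub>R b, snd c' x))" by (intro continuous_intros)
    then have "open ((\<lambda>t. (t *\<^sub>R b, snd c' x)) -` W)" using c'(2) open_vimage by blast
    moreover have "(\<lambda>t. (t *\<^sub>R b, x)) -` G = (if x \<in> fst c' then (\<lambda>t. (t *\<^sub>R b, snd c' x)) -` W else {})"
      by (auto simp: c'(3))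
    ultimately show "openin euclideanreal ((\<lambda>t. (t *\<^sub>R b, x)) -` G \<inter> topspace euclideanreal)"
      by simp
  next
    have "(t *\<^sub>R b, x) \<in> points ?S" for t
    proof -
      obtain c where c: "c \<in> A" "x \<in> fst c" using x by (auto simp: points_def)
      then have "(UNIV \<times> fst c, map_prod id (snd c)) \<in> ?S"
        unfolding prod_atlas_def by (intro CollectI exI[of _ "(UNIV, id)"] exI[of _ c]) simp
      then show ?thesis using c(2) unfolding points_def by force
    qed
    then show "(\<lambda>t. (t *\<^sub>R b, x)) ` topspace euclideanreal
        \<subseteq> \<Union> {fst c \<inter> snd c -` W |c W. c \<in> ?S \<and> open W}"
      using topspace_mtop[of ?S] unfolding mtop_def topology_generated_by_topspace by auto
  qed
  then have "continuous_map euclideanreal (subtopology (mtop ?S) (UNIV \<times> points A)) (\<lambda>t. (t *\<^sub>R b, x))"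
    using x by (auto simp: continuous_map_in_subtopology)
  from continuous_map_compose[OF this act] show ?thesis by (simp add: comp_def)
qed

lemma admissible_pushed_forward_field:
  assumes "injective_charts (tangent_atlas M)" "injective_charts B"
    and open_sets: "openin (mtop (tangent_atlas M)) U" "openin (mtop B) V"
    and "diffeomorphism (tangent_atlas M) U B V \<Phi>"
    and adm: "admissible_via M U \<theta> \<psi> X \<Theta>"
  shows "pushed_forward_field (tangent_atlas M) U B V \<Phi> (X i)"
proof
  fix x assume "x \<in> U"
  then have x: "x \<in> points (tangent_atlas M)"
    using openin_subset[OF open_sets(1)] by (auto simp: topspace_mtop)
  have "continuous_map (subtopology (mtop (prod_atlas {(UNIV, id)} (tangent_atlas M)))
      (UNIV \<times> points (tangent_atlas M))) (mtop (tangent_atlas M)) (\<lambda>(v, x). \<psi> v x)"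
    using adm by (simp add: admissible_via_def smooth_vertical_action_def smooth_map_def)
  moreover have "\<psi> 0 x = x"
    using adm x by (simp add: admissible_via_def smooth_vertical_action_def)
  moreover have "\<forall>c\<in>tangent_atlas M. x \<in> fst c \<longrightarrow>
      ((snd c \<circ> (\<lambda>t. \<psi> (t *\<^sub>R axis i 1) x)) has_vector_derivative X i x c) (at 0)"
    using adm x by (simp add: admissible_via_def fundamental_vector_fields_def comp_def)
  ultimately show "\<exists>\<eta>. continuous_map euclideanreal (mtop (tangent_atlas M)) \<eta> \<and> \<eta> 0 = x \<and>
      (\<forall>c\<in>tangent_atlas M. x \<in> fst c \<longrightarrow> ((snd c \<circ> \<eta>) has_vector_derivative X i x c) (at 0))"
    using continuous_action_orbit[OF _ x] by (intro exI[of _ "\<lambda>t. \<psi> (t *\<^sub>R axis i 1) x"]) simp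
qed (use assms in \<open>auto simp: admissible_via_def\<close>)

lemma diffeomorphism_homeomorphic_subspaces:
  assumes "diffeomorphism A U B V \<Phi>"
  shows "homeomorphic_subspaces (mtop A) U (mtop B) V \<Phi>"
proof
  show bij: "bij_betw \<Phi> U V" using assms by (simp add: diffeomorphism_def)
  have "continuous_map (subtopology (mtop A) U) (mtop B) \<Phi>"
    "continuous_map (subtopology (mtop B) V) (mtop A) (inv_into U \<Phi>)"
    using assms unfolding diffeomorphism_def smooth_map_def by blast+
  then show "continuous_map (subtopology (mtop A) U) (subtopology (mtop B) V) \<Phi>"
    "continuous_map (subtopology (mtop B) V) (subtopology (mtop A) U) (inv_into U \<Phi>)"
    using bij bij_betw_inv_into[OF bij]
    by (auto simp: continuous_map_in_subtopology bij_betw_def topspace_subtopology inv_into_into)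
qed

section \<open>The isomorphism of the deformed algebras\<close>

lemma pullback_deformation_isomorphism:
  fixes Z :: "'d::{finite,linorder} \<Rightarrow> 'a \<Rightarrow> ('a, 'e::euclidean_space) tangent"
  assumes "\<And>i. pushed_forward_field A U B V \<Phi> (Z i)"
    and "function_transport U \<Phi> F P G Q"
    and norms: "(\<lambda>q f. q (pullback U \<Phi> f)) ` QG \<subseteq> QF"
  defines "\<alpha> \<equiv> induced_action A (points A) U Z"
    and "\<alpha>' \<equiv> induced_action B V V (\<lambda>i. pushforward A U B \<Phi> (Z i))"
  shows "star_isomorphism (smooth_vectors F P \<alpha>') (deformed_product F P \<alpha>' \<Theta>)
           (smooth_vectors G Q \<alpha>) (deformed_product G Q \<alpha> \<Theta>) (pullback U \<Phi>)
       \<and> continuous_map (deformed_topology F P \<alpha>' \<Theta> QF) (deformed_topology G Q \<alpha> \<Theta> QG) (pullback U \<Phi>)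
       \<and> (\<forall>f\<in>smooth_vectors G Q \<alpha>.
            inv_into (smooth_vectors F P \<alpha>') (pullback U \<Phi>) f = push_function U \<Phi> f)"
proof -
  have equivariant: "\<alpha> v (pullback U \<Phi> a) = pullback U \<Phi> (\<alpha>' v a)" for v a
    unfolding \<alpha>_def \<alpha>'_def using assms(1) by (rule induced_action_pullback)
  have "\<Phi> ` U = V"
    using pushed_forward_field.bij[OF assms(1)] by (simp add: bij_betw_def)
  then have supported: "\<forall>y. y \<notin> \<Phi> ` U \<longrightarrow> \<alpha>' v a y = 0" for v a
    by (simp add: \<alpha>'_def induced_action_def)
  note transport = function_transport.transport_deformation[OF assms(2), of \<alpha> \<alpha>' QG QF,
      OF equivariant supported]
  have "(\<lambda>f. q (pullback U \<Phi> f)) \<in> QF" if "q \<in> QG" for q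
    using norms that by blast
  then show ?thesis
    by (intro conjI transport)
qed

theorem proposition4p3:
  fixes M :: "('m, 'e::euclidean_space) atlas"
    and nabla :: "('m \<Rightarrow> ('m, 'e) tangent) \<Rightarrow> ('m \<Rightarrow> ('m, 'e) tangent) \<Rightarrow> 'm \<Rightarrow> ('m, 'e) tangent"
    and TM :: "('m \<times> ('m, 'e) tangent, 'e \<times> 'e) atlas"
    and MM :: "('m \<times> 'm, 'e \<times> 'e) atlas"
    and U :: "('m \<times> ('m, 'e) tangent) set"
    and V :: "('m \<times> 'm) set"
    and \<Phi> :: "'m \<times> ('m, 'e) tangent \<Rightarrow> 'm \<times> 'm"
    and \<theta> :: "'m \<times> ('m, 'e) tangent \<Rightarrow> ('m \<times> ('m, 'e) tangent, 'e \<times> 'e) bivector"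
    and \<psi> :: "real^'d::{finite,linorder} \<Rightarrow> 'm \<times> ('m, 'e) tangent \<Rightarrow> 'm \<times> ('m, 'e) tangent"
    and X :: "'d::{finite,linorder} \<Rightarrow> 'm \<times> ('m, 'e) tangent \<Rightarrow> ('m \<times> ('m, 'e) tangent, 'e \<times> 'e) tangent"
    and X' :: "'d::{finite,linorder} \<Rightarrow> 'm \<times> 'm \<Rightarrow> ('m \<times> 'm, 'e \<times> 'e) tangent"
    and \<Theta> :: "real^'d::{finite,linorder}^'d::{finite,linorder}"
    and \<alpha> :: "real^'d::{finite,linorder} \<Rightarrow> ('m \<times> ('m, 'e) tangent \<Rightarrow> complex) \<Rightarrow> 'm \<times> ('m, 'e) tangent \<Rightarrow> complex"
    and \<alpha>' :: "real^'d::{finite,linorder} \<Rightarrow> ('m \<times> 'm \<Rightarrow> complex) \<Rightarrow> 'm \<times> 'm \<Rightarrow> complex"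
  assumes "smooth_manifold M"
    and "affine_connection M nabla" and "torsion_free M nabla"
    and "TM = tangent_atlas M" and "MM = prod_atlas M M"
    and "openin (mtop TM) U" and "zero_section M \<subseteq> U"
    and "openin (mtop MM) V" and "Id_on (points M) \<subseteq> V"
    and "\<Phi> = sym_exp M nabla" and "sym_exp_defined_on M nabla U"
    and "diffeomorphism TM U MM V \<Phi>"
    and "vertical_poisson_structure M \<theta>"
    and "admissible_via M U \<theta> \<psi> X \<Theta>"
    and "X' = (\<lambda>i. pushforward TM U MM \<Phi> (X i))"
    and "\<alpha> = induced_action TM (points TM) U X"
    and "\<alpha>' = induced_action MM V V X'"
  shows
    "pullback U \<Phi> \<in> C0 (mtop MM) V \<rightarrow> C0 (mtop TM) U
     \<and> (let A = C0 (mtop MM) V; P = compact_seminorms (mtop MM) V;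
            B = C0 (mtop TM) U; Q = compact_seminorms (mtop TM) U
        in star_isomorphism (smooth_vectors A P \<alpha>') (deformed_product A P \<alpha>' \<Theta>)
             (smooth_vectors B Q \<alpha>) (deformed_product B Q \<alpha> \<Theta>) (pullback U \<Phi>)
           \<and> continuous_map (deformed_topology A P \<alpha>' \<Theta> (cstar_seminorms A P))
               (deformed_topology B Q \<alpha> \<Theta> (cstar_seminorms B Q)) (pullback U \<Phi>)
           \<and> (\<forall>f\<in>smooth_vectors B Q \<alpha>.
                inv_into (smooth_vectors A P \<alpha>') (pullback U \<Phi>) f = push_function U \<Phi> f))
     \<and> (let A = C0_bdd (mtop MM) V; P = {sup_seminorm V};
            B = C0_bdd (mtop TM) U; Q = {sup_seminorm U}
        in star_isomorphism (smooth_vectors A P \<alpha>') (deformed_product A P \<alpha>' \<Theta>)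
             (smooth_vectors B Q \<alpha>) (deformed_product B Q \<alpha> \<Theta>) (pullback U \<Phi>)
           \<and> continuous_map (deformed_topology A P \<alpha>' \<Theta> {sup_seminorm V})
               (deformed_topology B Q \<alpha> \<Theta> {sup_seminorm U}) (pullback U \<Phi>)
           \<and> (\<forall>f\<in>smooth_vectors B Q \<alpha>.
                inv_into (smooth_vectors A P \<alpha>') (pullback U \<Phi>) f = push_function U \<Phi> f))
     \<and> (let A = C0_van (mtop MM) V; P = {sup_seminorm V};
            B = C0_van (mtop TM) U; Q = {sup_seminorm U}
        in star_isomorphism (smooth_vectors A P \<alpha>') (deformed_product A P \<alpha>' \<Theta>)
             (smooth_vectors B Q \<alpha>) (deformed_product B Q \<alpha> \<Theta>) (pullback U \<Phi>)
           \<and> continuous_map (deformed_topology A P \<alpha>' \<Theta> {sup_seminorm V})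
               (deformed_topology B Q \<alpha> \<Theta> {sup_seminorm U}) (pullback U \<Phi>)
           \<and> (\<forall>f\<in>smooth_vectors B Q \<alpha>.
                inv_into (smooth_vectors A P \<alpha>') (pullback U \<Phi>) f = push_function U \<Phi> f))"
proof -
  note smooth_M = assms(1) and TM = assms(4) and MM = assms(5) and open_sets = assms(6,8)
    and diffeo = assms(12) and admissible = assms(14) and X' = assms(15) and actions = assms(16,17)
  have "injective_charts M"
    using smooth_M by (simp add: smooth_manifold_def smooth_atlas_def injective_charts_def)
  then have "injective_charts TM" "injective_charts MM"
    unfolding TM MM by (simp_all add: injective_charts_tangent_atlas injective_charts_prod_atlas)
  then have field: "pushed_forward_field TM U MM V \<Phi> (X i)" for i
    using open_sets diffeo admissible unfolding TM by (intro admissible_pushed_forward_field)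
  interpret homeomorphic_subspaces "mtop TM" U "mtop MM" V \<Phi>
    using diffeo by (rule diffeomorphism_homeomorphic_subspaces)
  have cstar: "(\<lambda>q f. q (pullback U \<Phi> f)) ` cstar_seminorms (C0 (mtop TM) U) (compact_seminorms (mtop TM) U)
      \<subseteq> cstar_seminorms (C0 (mtop MM) V) (compact_seminorms (mtop MM) V)"
    using function_transport.cstar_seminorm_pullback[OF transport_C0 compact_seminorms_local] by blast
  have sup: "(\<lambda>q f. q (pullback U \<Phi> f)) ` {sup_seminorm U} \<subseteq> {sup_seminorm V}"
    unfolding sup_seminorm_transport by (rule order_refl)
  have pull: "pullback U \<Phi> \<in> C0 (mtop MM) V \<rightarrow> C0 (mtop TM) U"
    using pullback_C0[OF cont] by blast
  note isomorphism = pullback_deformation_isomorphism[where Z = X, OF field]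
  show ?thesis
    unfolding actions X' Let_def
    by (intro conjI[OF pull conjI[OF isomorphism[OF transport_C0 cstar]
      conjI[OF isomorphism[OF transport_C0_bdd sup] isomorphism[OF transport_C0_van sup]]]])
qed

end
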